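(* Consider binary interval consensus on the complete graph with $n>1$ nodes, i.e. with contact rates $q_{i,j}=1/(n-1)$ for all $i\ne j$, started from an initial state in which $|S_0|$ nodes are in state $0$ and $|S_1|$ nodes are in state $1$, with $|S_0|+|S_1|=n$ and $|S_0|>|S_1|>0$. Let $T_1$ be the first instant at which no node is in state $1$ (the duration of the first convergence phase). Then $$\mathbb{E}(T_1)=\frac{n-1}{|S_0|-|S_1|}\left(H_{|S_1|}+H_{|S_0|-|S_1|}-H_{|S_0|}\right),\qquad H_k=\sum_{i=1}^k\frac1i .$$ Furthermore, for every fixed $\alpha\in(1/2,1)$, if $|S_0|=\alpha n$ and $|S_1|=(1-\alpha)n$, then as $n\to\infty$ (along $n$ with $\alpha n$ an integer) $$\mathbb{E}(T_1)=\frac{1}{2\alpha-1}\log(n)+O(1).$$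
   Context: Binary interval consensus with contact rates $Q=(q_{i,j})$ on $V=\{1,\dots,n\}$ ($Q$ symmetric, non-negative, zero diagonal): each unordered pair of nodes $\{i,j\}$ gets in contact at the instances of a Poisson process of rate $q_{i,j}$, independently over pairs. At each time every node is in one of the four states $0,e_0,e_1,1$. When two nodes get in contact their states are updated as follows (first node, second node): $(0,1)\to(e_1,e_0)$; $(e_0,1)\to(1,e_1)$; $(e_1,0)\to(0,e_0)$; $(e_0,0)\to(0,e_0)$; $(e_1,1)\to(1,e_1)$; $(e_0,e_1)\to(e_1,e_0)$. For any other pair of states nothing changes. *)

theory Defs
  imports "HOL-Probability.Probability"
begin

datatype node_state = St0 | StE0 | StE1 | St1

text \<open>
  A contact involves an unordered pair of nodes, so every update rule is listed in both
  orientations; lemma \<open>meet_commute\<close> below records that the result does not depend on the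
  orientation in which a pair is read.
\<close>

fun interact :: "node_state \<Rightarrow> node_state \<Rightarrow> node_state \<times> node_state" where
  "interact St0 St1 = (StE1, StE0)"
| "interact St1 St0 = (StE0, StE1)"
| "interact StE0 St1 = (St1, StE1)"
| "interact St1 StE0 = (StE1, St1)"
| "interact StE1 St0 = (St0, StE0)"
| "interact St0 StE1 = (StE0, St0)"
| "interact StE0 St0 = (St0, StE0)"
| "interact St0 StE0 = (StE0, St0)"
| "interact StE1 St1 = (St1, StE1)"
| "interact St1 StE1 = (StE1, St1)"
| "interact StE0 StE1 = (StE1, StE0)"
| "interact StE1 StE0 = (StE0, StE1)"
| "interact a b = (a, b)"

definition meet :: "nat \<Rightarrow> nat \<Rightarrow> (nat \<Rightarrow> node_state) \<Rightarrow> nat \<Rightarrow> node_state" where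
  "meet i j x = x(i := fst (interact (x i) (x j)), j := snd (interact (x i) (x j)))"

lemma interact_swap: "interact b a = prod.swap (interact a b)"
  by (cases a; cases b) simp_all

lemma meet_commute: "i \<noteq> j \<Longrightarrow> meet j i x = meet i j x"
  by (auto simp: meet_def interact_swap[of "x i" "x j"] fun_upd_twist)

definition node_pairs :: "nat \<Rightarrow> nat set set" where
  "node_pairs n = {{i, j} | i j. i \<in> {1..n} \<and> j \<in> {1..n} \<and> i \<noteq> j}"

text \<open>
  Poisson process of rate \<open>q \<ge> 0\<close>, given by its counting process \<open>N\<close>. The explicit Poisson
  weights also cover \<open>q * (t - s) = 0\<close>, where \<open>0 ^ 0 = 1\<close> yields the point mass at zero.
  Independence is stated for infinite nondecreasing sequences of times; finite sequences are
  the case of a sequence that is eventually constant.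
\<close>

definition (in prob_space) poisson_process :: "real \<Rightarrow> (real \<Rightarrow> 'a \<Rightarrow> nat) \<Rightarrow> bool" where
  "poisson_process q N \<longleftrightarrow>
     (\<forall>t\<ge>0. N t \<in> M \<rightarrow>\<^sub>M count_space UNIV) \<and>
     (\<forall>\<omega>\<in>space M. N 0 \<omega> = 0 \<and> mono_on {0..} (\<lambda>t. N t \<omega>) \<and>
        (\<forall>t\<ge>0. \<forall>\<^sub>F s in at_right t. N s \<omega> = N t \<omega>)) \<and>
     (\<forall>s t k. 0 \<le> s \<longrightarrow> s \<le> t \<longrightarrow>
        prob {\<omega> \<in> space M. N t \<omega> - N s \<omega> = k}
          = exp (- (q * (t - s))) * (q * (t - s)) ^ k / fact k) \<and>
     (\<forall>\<tau> :: nat \<Rightarrow> real. 0 \<le> \<tau> 0 \<longrightarrow> mono \<tau> \<longrightarrow>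
        indep_vars (\<lambda>_. count_space UNIV) (\<lambda>k \<omega>. N (\<tau> (Suc k)) \<omega> - N (\<tau> k) \<omega>) UNIV)"

text \<open>The instances of the point process counted by \<open>f\<close> are the jump times of \<open>f\<close>.\<close>

definition jumps_at :: "(real \<Rightarrow> nat) \<Rightarrow> real \<Rightarrow> bool" where
  "jumps_at f t \<longleftrightarrow> 0 < t \<and> (\<forall>s. 0 \<le> s \<longrightarrow> s < t \<longrightarrow> f s < f t)"

text \<open>
  \<open>N e t\<close> counts the contacts of the pair \<open>e\<close> up to time \<open>t\<close>, and \<open>X t \<omega> i\<close> is the state of
  node \<open>i\<close> at time \<open>t\<close>. In \<open>dynamics\<close>, \<open>x\<close> is the configuration just before time \<open>t\<close>. Almost
  surely no two pairs are in contact at the same instant; the exceptional null set, on which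
  the update rule is ambiguous, is left unconstrained by \<open>dynamics\<close>.
\<close>

locale interval_consensus = prob_space M for M :: "'w measure" +
  fixes n :: nat
    and q :: "nat \<Rightarrow> nat \<Rightarrow> real"
    and x0 :: "nat \<Rightarrow> node_state"
    and N :: "nat set \<Rightarrow> real \<Rightarrow> 'w \<Rightarrow> nat"
    and X :: "real \<Rightarrow> 'w \<Rightarrow> nat \<Rightarrow> node_state"
  assumes rate_sym: "\<And>i j. i \<in> {1..n} \<Longrightarrow> j \<in> {1..n} \<Longrightarrow> q i j = q j i"
    and rate_nonneg: "\<And>i j. i \<in> {1..n} \<Longrightarrow> j \<in> {1..n} \<Longrightarrow> 0 \<le> q i j"
    and rate_diag: "\<And>i. i \<in> {1..n} \<Longrightarrow> q i i = 0"
    and contacts_poisson: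
      "\<And>i j. i \<in> {1..n} \<Longrightarrow> j \<in> {1..n} \<Longrightarrow> i \<noteq> j \<Longrightarrow> poisson_process (q i j) (N {i, j})"
    and contacts_indep:
      "indep_vars (\<lambda>_. Pi\<^sub>M {0..} (\<lambda>_. count_space UNIV)) (\<lambda>e \<omega>. \<lambda>t\<in>{0..}. N e t \<omega>) (node_pairs n)"
    and state_measurable:
      "\<And>t i. 0 \<le> t \<Longrightarrow> i \<in> {1..n} \<Longrightarrow> (\<lambda>\<omega>. X t \<omega> i) \<in> M \<rightarrow>\<^sub>M count_space UNIV"
    and initial_state:
      "\<And>\<omega> i. \<omega> \<in> space M \<Longrightarrow> i \<in> {1..n} \<Longrightarrow> X 0 \<omega> i = x0 i"
    and right_continuous:
      "\<And>\<omega> t i. \<omega> \<in> space M \<Longrightarrow> 0 \<le> t \<Longrightarrow> i \<in> {1..n} \<Longrightarrow> \<forall>\<^sub>F s in at_right t. X s \<omega> i = X t \<omega> i"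
    and dynamics:
      "AE \<omega> in M. \<forall>t>0. \<exists>x.
         (\<forall>i\<in>{1..n}. \<forall>\<^sub>F s in at_left t. X s \<omega> i = x i) \<and>
         (\<forall>i\<in>{1..n}. \<forall>j\<in>{1..n}. i \<noteq> j \<and> jumps_at (\<lambda>s. N {i, j} s \<omega>) t \<longrightarrow>
            (\<forall>k\<in>{1..n}. X t \<omega> k = meet i j x k)) \<and>
         ((\<forall>e\<in>node_pairs n. \<not> jumps_at (\<lambda>s. N e s \<omega>) t) \<longrightarrow>
            (\<forall>k\<in>{1..n}. X t \<omega> k = x k))"

definition complete_graph_rate :: "nat \<Rightarrow> nat \<Rightarrow> nat \<Rightarrow> real" where
  "complete_graph_rate n i j = (if i = j then 0 else 1 / (real n - 1))"

definition initial_count :: "nat \<Rightarrow> (nat \<Rightarrow> node_state) \<Rightarrow> node_state \<Rightarrow> nat" where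
  "initial_count n x0 a = card {i \<in> {1..n}. x0 i = a}"

text \<open>The duration of the first phase, with value \<open>\<infinity>\<close> if state \<open>St1\<close> never disappears.\<close>

definition first_phase_duration ::
    "nat \<Rightarrow> (real \<Rightarrow> 'w \<Rightarrow> nat \<Rightarrow> node_state) \<Rightarrow> 'w \<Rightarrow> ennreal" where
  "first_phase_duration n X \<omega> = (INF t \<in> {t. 0 \<le> t \<and> (\<forall>i\<in>{1..n}. X t \<omega> i \<noteq> St1)}. ennreal t)"

end

theory Submission
  imports Defs "HOL-Real_Asymp.Real_Asymp"
begin

text \<open>
  Only a contact between a node in state \<open>St0\<close> and a node in state \<open>St1\<close> changes the number of
  nodes in either of these states, and it lowers both numbers by one. So the surplus
  \<open>D = S0 - S1\<close> is conserved, and with \<open>c\<close> ones left there are \<open>c * (c + D)\<close> pairs whose next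
  contact removes a one. Each pair has rate \<open>1 / (n - 1)\<close>, so the number of ones stays at \<open>c\<close> for
  a mean time \<open>(n - 1) / (c * (c + D))\<close>. The expected duration is the sum of these means over
  \<open>c = 1, ..., S1\<close>, which a partial fraction decomposition turns into harmonic numbers
  (\<open>phase_potential_harm\<close>). The asymptotic claim follows because \<open>harm k\<close> differs from \<open>ln k\<close> by
  at most one: the logarithms of \<open>(1 - \<alpha>) n\<close>, \<open>(2 \<alpha> - 1) n\<close> and \<open>\<alpha> n\<close> combine to \<open>ln n\<close> plus
  a constant.

  The rigorous version of the holding time argument takes the partial sum
  \<open>F c = phase_potential n D c\<close> of these means as a potential. The generator of the process maps
  it to minus the indicator that a one is left (\<open>phase_potential_generator\<close>). To avoid the Markov
  property of the continuous time process, time is cut into \<open>m\<close> intervals of length \<open>h\<close>, and the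
  trajectory is compared with a discrete chain that applies a contact whenever it is the only one
  of its interval. The increments of the Poisson processes over all pairs and intervals are
  jointly independent (\<open>indep_vars_Times\<close>), so the state of the chain is independent of the
  increments that drive its next step, and the expected potential of the chain decreases in each
  step by exactly \<open>h * exp (- (\<Lambda> * h))\<close> times the probability that a one is left, where \<open>\<Lambda>\<close> is
  the total contact rate (\<open>potential_step\<close>).

  Chain and trajectory agree on the grid unless some interval contains two contacts, which has
  probability at most \<open>m * (\<Lambda> * h)^2\<close> (\<open>prob_unresolved\<close>). If they agree, then \<open>h\<close> times the
  number of grid points with a one left approximates the duration, truncated at \<open>h * m\<close>, up to
  \<open>h\<close> (\<open>duration_grid_approx\<close>). With \<open>h * m = k\<close> and \<open>m = k^4\<close> all errors vanish as \<open>k\<close> grows,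
  and monotone convergence removes the truncation.
\<close>

section \<open>Independence over a product of index sets\<close>

text \<open>
  If whole rows are independent and the entries of each row are independent, then all entries
  are: a finite intersection of events groups into one event per row, and the probability
  factorises first over the rows and then within each row.
\<close>

lemma (in prob_space) indep_vars_Times:
  assumes rows: "indep_vars (\<lambda>_. PiM K (\<lambda>_. N)) (\<lambda>i \<omega>. \<lambda>k\<in>K. X i k \<omega>) I"
    and within: "\<And>i. i \<in> I \<Longrightarrow> indep_vars (\<lambda>_. N) (X i) K"
  shows "indep_vars (\<lambda>_. N) (\<lambda>(i, k). X i k) (I \<times> K)"
  unfolding indep_vars_def2
proof (intro conjI ballI indep_setsI)
  have rv: "random_variable N (X i k)" if "i \<in> I" "k \<in> K" for i k
    using within[OF that(1)] that(2) by (auto simp: indep_vars_def2)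
  show "random_variable N (case j of (i, k) \<Rightarrow> X i k)" if "j \<in> I \<times> K" for j
    using that rv by auto
  show "{(case j of (i, k) \<Rightarrow> X i k) -` A \<inter> space M |A. A \<in> sets N} \<subseteq> events"
    if "j \<in> I \<times> K" for j
    using that rv by (auto intro: measurable_sets)
  fix A J
  assume J: "J \<noteq> {}" "J \<subseteq> I \<times> K" "finite J"
    and "\<forall>j\<in>J. A j \<in> {(case j of (i, k) \<Rightarrow> X i k) -` A \<inter> space M |A. A \<in> sets N}"
  then have "\<forall>j\<in>J. \<exists>B\<in>sets N. A j = X (fst j) (snd j) -` B \<inter> space M"
    by (force simp: case_prod_unfold)
  then obtain B where B: "\<And>j. j \<in> J \<Longrightarrow> B j \<in> sets N"
      "\<And>j. j \<in> J \<Longrightarrow> A j = X (fst j) (snd j) -` B j \<inter> space M"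
    by metis
  \<comment> \<open>\<open>K' i\<close> lists the columns used in row \<open>i\<close>, and \<open>S i\<close> is the event of row \<open>i\<close>.\<close>
  define I' where "I' = fst ` J"
  define K' where "K' i = {k. (i, k) \<in> J}" for i
  define S where "S i = (\<Inter>k\<in>K' i. (\<lambda>f. f k) -` B (i, k) \<inter> space (PiM K (\<lambda>_. N)))" for i
  have I': "I' \<noteq> {}" "finite I'" "I' \<subseteq> I" using J by (auto simp: I'_def)
  have K': "K' i \<noteq> {}" "finite (K' i)" "K' i \<subseteq> K" if "i \<in> I'" for i
  proof -
    have "K' i \<subseteq> snd ` J" by (force simp: K'_def)
    then show "finite (K' i)" using J(3) finite_surj by blast
  qed (use that J(2) in \<open>auto simp: K'_def I'_def\<close>)
  have J_eq: "J = Sigma I' K'" by (force simp: I'_def K'_def)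
  have S: "S i \<in> sets (PiM K (\<lambda>_. N))" if "i \<in> I'" for i
    unfolding S_def
  proof (rule sets.finite_INT)
    show "(\<lambda>f. f k) -` B (i, k) \<inter> space (PiM K (\<lambda>_. N)) \<in> sets (PiM K (\<lambda>_. N))"
      if k: "k \<in> K' i" for k
      using k K'(3)[OF \<open>i \<in> I'\<close>] B(1)[of "(i, k)"]
      by (intro measurable_sets[OF measurable_component_singleton]) (auto simp: K'_def)
  qed (use K'[OF that] in auto)
  have row_event: "(\<lambda>\<omega>. \<lambda>k\<in>K. X i k \<omega>) -` S i \<inter> space M
      = (\<Inter>k\<in>K' i. X i k -` B (i, k) \<inter> space M)" if i: "i \<in> I'" for i
  proof -
    have "(\<lambda>k\<in>K. X i k \<omega>) \<in> space (PiM K (\<lambda>_. N))" if "\<omega> \<in> space M" for \<omega>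
      using that rv[of i] i I'(3) by (auto simp: space_PiM dest: measurable_space)
    then have "(\<lambda>k\<in>K. X i k \<omega>) \<in> S i \<longleftrightarrow> (\<forall>k\<in>K' i. X i k \<omega> \<in> B (i, k))"
      if "\<omega> \<in> space M" for \<omega>
      using that K'(3)[OF i] by (simp add: S_def subset_iff)
    then show ?thesis
      using K'(1)[OF i] by auto
  qed
  have "(\<Inter>j\<in>J. A j) = (\<Inter>j\<in>J. X (fst j) (snd j) -` B j \<inter> space M)"
    using B(2) by auto
  also have "\<dots> = (\<Inter>i\<in>I'. \<Inter>k\<in>K' i. X i k -` B (i, k) \<inter> space M)"
    unfolding J_eq set_eq_iff INT_iff by auto
  also have "\<dots> = (\<Inter>i\<in>I'. (\<lambda>\<omega>. \<lambda>k\<in>K. X i k \<omega>) -` S i \<inter> space M)"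
    by (simp add: row_event)
  also have "prob \<dots> = (\<Prod>i\<in>I'. prob ((\<lambda>\<omega>. \<lambda>k\<in>K. X i k \<omega>) -` S i \<inter> space M))"
    using I' S by (intro indep_varsD[OF rows]) auto
  also have "\<dots> = (\<Prod>i\<in>I'. \<Prod>k\<in>K' i. prob (X i k -` B (i, k) \<inter> space M))"
  proof (rule prod.cong[OF refl])
    fix i assume i: "i \<in> I'"
    have "prob (\<Inter>k\<in>K' i. X i k -` B (i, k) \<inter> space M)
        = (\<Prod>k\<in>K' i. prob (X i k -` B (i, k) \<inter> space M))"
      using i I' K'[OF i] B(1) by (intro indep_varsD[OF within]) (auto simp: K'_def)
    then show "prob ((\<lambda>\<omega>. \<lambda>k\<in>K. X i k \<omega>) -` S i \<inter> space M)
        = (\<Prod>k\<in>K' i. prob (X i k -` B (i, k) \<inter> space M))"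
      by (simp add: row_event[OF i])
  qed
  also have "\<dots> = (\<Prod>j\<in>J. prob (A j))"
    using I' K' B(2) unfolding J_eq by (subst prod.Sigma) (auto intro!: prod.cong)
  finally show "prob (\<Inter>j\<in>J. A j) = (\<Prod>j\<in>J. prob (A j))" .
qed

section \<open>Contacts and the number of nodes in each state\<close>

text \<open>
  The two nodes are read off the unordered pair by \<open>Min\<close> and \<open>Max\<close>; by \<open>contact_pair\<close> this
  arbitrary orientation is harmless. Below, \<open>initial_count n x a\<close> counts the nodes in state \<open>a\<close>
  of an arbitrary configuration \<open>x\<close>.
\<close>

definition contact :: "nat set \<Rightarrow> (nat \<Rightarrow> node_state) \<Rightarrow> nat \<Rightarrow> node_state" where
  "contact e x = meet (Min e) (Max e) x"

lemma contact_pair: "i \<noteq> j \<Longrightarrow> contact {i, j} x = meet i j x"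
  using meet_commute[of i j x] by (auto simp: contact_def min_def max_def)

lemma contact_cong:
  assumes "e \<in> node_pairs n" "\<And>k. k \<in> {1..n} \<Longrightarrow> x k = y k" "k \<in> {1..n}"
  shows "contact e x k = contact e y k"
  using assms by (auto simp: node_pairs_def contact_pair meet_def)

lemma finite_node_pairs [simp]: "finite (node_pairs n)"
proof (rule finite_subset)
  show "node_pairs n \<subseteq> Pow {1..n}" by (auto simp: node_pairs_def)
qed simp

lemma initial_count_eq_0_iff: "initial_count n x a = 0 \<longleftrightarrow> (\<forall>i\<in>{1..n}. x i \<noteq> a)"
  by (auto simp: initial_count_def)

lemma initial_count_le: "initial_count n x a \<le> n"
proof -
  have "card {i \<in> {1..n}. x i = a} \<le> card {1..n}" by (rule card_mono) auto
  then show ?thesis by (simp add: initial_count_def)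
qed

lemma initial_count_split:
  assumes "i \<in> {1..n}" "j \<in> {1..n}" "i \<noteq> j"
  shows "initial_count n x a
    = of_bool (x i = a) + of_bool (x j = a) + card {k \<in> {1..n} - {i, j}. x k = a}"
proof -
  have "initial_count n x a = (\<Sum>k\<in>{1..n}. of_bool (x k = a))"
    by (simp add: initial_count_def flip: sum.inter_filter) (simp add: Int_def)
  also have "\<dots> = (\<Sum>k\<in>{i, j} \<union> ({1..n} - {i, j}). of_bool (x k = a))"
    using assms by (intro sum.cong) auto
  also have "\<dots> = (\<Sum>k\<in>{i, j}. of_bool (x k = a)) + (\<Sum>k\<in>{1..n} - {i, j}. of_bool (x k = a))"
    by (rule sum.union_disjoint) auto
  also have "(\<Sum>k\<in>{1..n} - {i, j}. of_bool (x k = a)) = card {k \<in> {1..n} - {i, j}. x k = a}"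
    by (simp flip: sum.inter_filter) (simp add: Int_def)
  finally show ?thesis using assms by simp
qed

definition opposed_pairs :: "nat \<Rightarrow> (nat \<Rightarrow> node_state) \<Rightarrow> nat set set" where
  "opposed_pairs n x = {e \<in> node_pairs n. x ` e = {St0, St1}}"

text \<open>
  The conservation law: the rules exchange or preserve the states \<open>St0\<close> and \<open>St1\<close> of the two
  nodes, except that an opposed pair loses one of each.
\<close>

lemma initial_count_contact:
  assumes "e \<in> node_pairs n" "a \<in> {St0, St1}"
  shows "initial_count n x a
    = initial_count n (contact e x) a + of_bool (e \<in> opposed_pairs n x)"
proof -
  obtain i j where e: "e = {i, j}" and ij: "i \<in> {1..n}" "j \<in> {1..n}" "i \<noteq> j"
    using assms(1) by (auto simp: node_pairs_def)
  have opp: "e \<in> opposed_pairs n x \<longleftrightarrow> {x i, x j} = {St0, St1}"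
    using assms(1) by (simp add: opposed_pairs_def e)
  have "card {k \<in> {1..n} - {i, j}. contact e x k = a} = card {k \<in> {1..n} - {i, j}. x k = a}"
    using ij by (intro arg_cong[where f = card]) (auto simp: e contact_pair meet_def)
  then show ?thesis
    using assms(2) ij unfolding initial_count_split[OF ij] opp
    by (cases "x i"; cases "x j") (auto simp: e contact_pair meet_def doubleton_eq_iff)
qed

lemma card_opposed_pairs:
  "card (opposed_pairs n x) = initial_count n x St0 * initial_count n x St1"
proof -
  let ?A = "{i \<in> {1..n}. x i = St0}" and ?B = "{i \<in> {1..n}. x i = St1}"
  have "bij_betw (\<lambda>(i, j). {i, j}) (?A \<times> ?B) (opposed_pairs n x)"
  proof (rule bij_betw_imageI)
    show "inj_on (\<lambda>(i, j). {i, j}) (?A \<times> ?B)"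
      by (auto simp: inj_on_def doubleton_eq_iff)
    show "(\<lambda>(i, j). {i, j}) ` (?A \<times> ?B) = opposed_pairs n x"
    proof (intro equalityI subsetI)
      fix e assume "e \<in> opposed_pairs n x"
      then obtain i j where e: "e = {i, j}" "i \<in> {1..n}" "j \<in> {1..n}" "{x i, x j} = {St0, St1}"
        by (auto simp: opposed_pairs_def node_pairs_def)
      then consider "x i = St0" "x j = St1" | "x i = St1" "x j = St0"
        by (auto simp: doubleton_eq_iff)
      then show "e \<in> (\<lambda>(i, j). {i, j}) ` (?A \<times> ?B)"
      proof cases
        case 1
        then show ?thesis using e by (intro image_eqI[of _ _ "(i, j)"]) auto
      next
        case 2
        then show ?thesis using e by (intro image_eqI[of _ _ "(j, i)"]) auto
      qed
    next
      fix e assume "e \<in> (\<lambda>(i, j). {i, j}) ` (?A \<times> ?B)"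
      then obtain i j where "e = {i, j}" "i \<in> ?A" "j \<in> ?B" by auto
      moreover from this have "i \<noteq> j" by auto
      ultimately show "e \<in> opposed_pairs n x"
        by (auto simp: opposed_pairs_def node_pairs_def)
    qed
  qed
  then show ?thesis
    by (simp add: bij_betw_same_card[symmetric] card_cartesian_product initial_count_def)
qed

section \<open>The potential of the first phase\<close>

text \<open>
  The expected time until \<open>c\<close> ones have vanished when there are \<open>D\<close> more zeros than ones: the
  sum of the mean holding times \<open>(n - 1) / (j * (j + D))\<close>.
\<close>

definition phase_potential :: "nat \<Rightarrow> nat \<Rightarrow> nat \<Rightarrow> real" where
  "phase_potential n D c = (\<Sum>j=1..c. (real n - 1) / (real j * real (j + D)))"

lemma phase_potential_nonneg: "0 < n \<Longrightarrow> 0 \<le> phase_potential n D c"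
  by (auto simp: phase_potential_def intro!: sum_nonneg divide_nonneg_nonneg)

lemma phase_potential_mono: "0 < n \<Longrightarrow> c \<le> c' \<Longrightarrow> phase_potential n D c \<le> phase_potential n D c'"
  by (auto simp: phase_potential_def intro!: sum_mono2 divide_nonneg_nonneg)

lemma phase_potential_harm:
  assumes "0 < D"
  shows "phase_potential n D c = (real n - 1) / real D * (harm c + harm D - harm (c + D))"
proof (induction c)
  case 0
  then show ?case by (simp add: phase_potential_def harm_def)
next
  case (Suc c)
  have "(real n - 1) / (real (Suc c) * real (Suc c + D))
      = (real n - 1) / real D * (inverse (real (Suc c)) - inverse (real (Suc c + D)))"
    using assms by (simp add: divide_simps)
  moreover have "phase_potential n D (Suc c)
      = phase_potential n D c + (real n - 1) / (real (Suc c) * real (Suc c + D))"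
    by (simp add: phase_potential_def)
  ultimately show ?case
    unfolding Suc by (simp add: harm_Suc add_divide_distrib diff_divide_distrib distrib_left right_diff_distrib)
qed

text \<open>
  Each of the \<open>c * (c + D)\<close> opposed pairs lowers the potential by its last summand, which is
  the reciprocal of this number up to the factor \<open>n - 1\<close>. Multiplied by the rate \<open>1 / (n - 1)\<close>
  of a pair, the left-hand side is the generator of the process applied to the potential.
\<close>

lemma phase_potential_generator:
  assumes diff: "initial_count n x St0 = initial_count n x St1 + D"
  shows "(\<Sum>e\<in>node_pairs n. phase_potential n D (initial_count n (contact e x) St1)
            - phase_potential n D (initial_count n x St1))
    = - (real n - 1) * of_bool (0 < initial_count n x St1)"
proof -
  define c where "c = initial_count n x St1"
  let ?F = "phase_potential n D"
  have "(\<Sum>e\<in>node_pairs n. ?F (initial_count n (contact e x) St1) - ?F c)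
      = (\<Sum>e\<in>opposed_pairs n x. ?F (c - 1) - ?F c)"
  proof (rule sum.mono_neutral_cong_right)
    show "opposed_pairs n x \<subseteq> node_pairs n" by (auto simp: opposed_pairs_def)
    show "\<forall>e\<in>node_pairs n - opposed_pairs n x. ?F (initial_count n (contact e x) St1) - ?F c = 0"
    proof
      fix e assume "e \<in> node_pairs n - opposed_pairs n x"
      then show "?F (initial_count n (contact e x) St1) - ?F c = 0"
        using initial_count_contact[of e n St1 x] by (simp add: c_def)
    qed
    show "?F (initial_count n (contact e x) St1) - ?F c = ?F (c - 1) - ?F c"
      if "e \<in> opposed_pairs n x" for e
      using initial_count_contact[of e n St1 x] that by (simp add: c_def opposed_pairs_def)
  qed simp
  also have "\<dots> = real ((c + D) * c) * (?F (c - 1) - ?F c)"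
    by (simp add: card_opposed_pairs diff flip: c_def)
  also have "\<dots> = - (real n - 1) * of_bool (0 < c)"
  proof (cases c)
    case (Suc b)
    have cancel: "u * v * - (w / (v * u)) = - w" if "0 < u" "0 < v" for u v w :: real
      using that by simp
    have "?F (c - 1) - ?F c = - ((real n - 1) / (real c * real (c + D)))"
      by (simp add: Suc phase_potential_def)
    then show ?thesis
      using cancel[of "real (c + D)" "real c" "real n - 1"] by (simp only: of_nat_mult) (simp add: Suc)
  qed simp
  finally show ?thesis by (simp only: c_def)
qed

section \<open>Jumps of counting paths\<close>

lemma no_jump_if_no_increment:
  assumes "mono_on {0..} f" "0 \<le> a" "a < t" "t \<le> b" "f b = f a"
  shows "\<not> jumps_at f t"
proof
  assume "jumps_at f t"
  then have "f a < f t" using assms by (auto simp: jumps_at_def)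
  moreover have "f t \<le> f b" using assms(2-4) by (intro mono_onD[OF assms(1)]) auto
  ultimately show False using assms by simp
qed

text \<open>
  The jump is located at the infimum of the times at which the higher value has been reached;
  right continuity puts the infimum itself among these times.
\<close>

lemma unique_jump_if_unit_increment:
  fixes f :: "real \<Rightarrow> nat"
  assumes mono: "mono_on {0..} f" and rc: "\<And>t. 0 \<le> t \<Longrightarrow> \<forall>\<^sub>F s in at_right t. f s = f t"
    and ab: "0 \<le> a" "a \<le> b" and unit: "f b = Suc (f a)"
  shows "\<exists>!\<tau>. a < \<tau> \<and> \<tau> \<le> b \<and> jumps_at f \<tau>"
proof -
  define S where "S = {s. a \<le> s \<and> s \<le> b \<and> f s = f b}"
  define \<tau> where "\<tau> = Inf S"
  have S: "b \<in> S" "bdd_below S" using ab by (auto simp: S_def intro: bdd_belowI[of _ a])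
  have \<tau>_ab: "a \<le> \<tau>" "\<tau> \<le> b"
    using S by (auto simp: \<tau>_def S_def intro!: cInf_greatest cInf_lower)
  have le: "f s \<le> f t" if "0 \<le> s" "s \<le> t" for s t
    using that by (auto intro: mono_onD[OF mono])
  have f_\<tau>: "f \<tau> = f b"
  proof (rule ccontr)
    assume neq: "f \<tau> \<noteq> f b"
    then have "\<tau> < b" using \<tau>_ab by (cases "\<tau> = b") auto
    obtain c where c: "\<tau> < c" "\<And>s. \<tau> < s \<Longrightarrow> s < c \<Longrightarrow> f s = f \<tau>"
      using rc[of \<tau>] \<tau>_ab ab by (auto simp: eventually_at_right[OF \<open>\<tau> < b\<close>])
    obtain s where s: "s \<in> S" "s < c"
      using c(1) S cInf_less_iff[of S c] unfolding \<tau>_def by blast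
    moreover have "\<tau> \<le> s" using s S by (auto simp: \<tau>_def intro: cInf_lower)
    ultimately show False using c(2)[of s] neq by (cases "s = \<tau>") (auto simp: S_def)
  qed
  then have "a < \<tau>" using \<tau>_ab unit by (cases "a = \<tau>") auto
  have before: "f s = f a" if "a \<le> s" "s < \<tau>" for s
  proof -
    have "s \<notin> S" using that S cInf_lower[of s S] by (auto simp: \<tau>_def)
    then have "f s \<noteq> f b" using that \<tau>_ab by (auto simp: S_def)
    moreover have "f a \<le> f s" "f s \<le> f b" using that ab \<tau>_ab by (auto intro: le)
    ultimately show ?thesis using unit by linarith
  qed
  have jump: "jumps_at f \<tau>"
    unfolding jumps_at_def
  proof (intro conjI allI impI)
    fix s assume s: "0 \<le> s" "s < \<tau>"
    have "f s \<le> f (max a s)" using s ab by (auto intro: le)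
    also have "\<dots> = f a" using s \<open>a < \<tau>\<close> by (intro before) auto
    finally show "f s < f \<tau>" using f_\<tau> unit by simp
  qed (use ab \<open>a < \<tau>\<close> in auto)
  have "\<sigma> = \<tau>" if \<sigma>: "a < \<sigma>" "\<sigma> \<le> b" "jumps_at f \<sigma>" for \<sigma>
  proof (rule ccontr)
    assume "\<sigma> \<noteq> \<tau>"
    then consider "\<sigma> < \<tau>" | "\<tau> < \<sigma>" by linarith
    then show False
    proof cases
      case 1
      then show False using \<sigma> ab before[of \<sigma>] by (auto simp: jumps_at_def)
    next
      case 2
      then have "f \<tau> < f \<sigma>" using \<sigma>(3) ab \<open>a < \<tau>\<close> by (simp add: jumps_at_def)
      moreover have "f \<sigma> \<le> f b" using \<sigma> ab by (intro le) auto
      ultimately show False using f_\<tau> by simp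
    qed
  qed
  then show ?thesis using \<open>a < \<tau>\<close> \<tau>_ab(2) jump by (intro ex1I[of _ \<tau>]) blast+
qed

text \<open>
  Values lie in a type without topology, so constancy comes from connectedness of the interval
  and local constancy at each of its points.
\<close>

lemma constant_on_Icc:
  fixes g :: "real \<Rightarrow> 'b"
  assumes "a \<le> b"
    and right: "\<And>t. a \<le> t \<Longrightarrow> t < b \<Longrightarrow> \<forall>\<^sub>F s in at_right t. g s = g t"
    and left: "\<And>t. a < t \<Longrightarrow> t \<le> b \<Longrightarrow> \<forall>\<^sub>F s in at_left t. g s = g t"
  shows "g b = g a"
proof (cases "a = b")
  case False
  then have "a < b" using assms by simp
  show ?thesis
  proof (rule connected_local_const[of "{a..b}", symmetric])
    show "\<forall>t\<in>{a..b}. \<forall>\<^sub>F s in at t within {a..b}. g t = g s"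
    proof
      fix t assume "t \<in> {a..b}"
      then consider "t = a" | "t = b" | "a < t" "t < b" by fastforce
      then show "\<forall>\<^sub>F s in at t within {a..b}. g t = g s"
      proof cases
        case 1
        then show ?thesis using right[of a] \<open>a < b\<close>
          by (simp add: at_within_Icc_at_right eq_commute)
      next
        case 2
        then show ?thesis using left[of b] \<open>a < b\<close>
          by (simp add: at_within_Icc_at_left eq_commute)
      next
        case 3
        then show ?thesis using left[of t] right[of t]
          by (simp add: at_within_Icc_at eventually_at_split eq_commute)
      qed
    qed
  qed (use \<open>a < b\<close> in auto)
qed simp

section \<open>The chain along a time grid\<close>

definition sole_contact :: "nat \<Rightarrow> (nat set \<Rightarrow> nat) \<Rightarrow> nat set \<Rightarrow> bool" where
  "sole_contact n d e \<longleftrightarrow> e \<in> node_pairs n \<and> (\<forall>e'\<in>node_pairs n. d e' = of_bool (e' = e))"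

text \<open>
  One step of the chain, driven by the contact counts \<open>d\<close> of one interval. An interval with
  several contacts leaves the configuration unchanged: their order cannot be recovered from the
  counts, and such intervals only contribute to the error.
\<close>

definition grid_step :: "nat \<Rightarrow> (nat set \<Rightarrow> nat) \<Rightarrow> (nat \<Rightarrow> node_state) \<Rightarrow> nat \<Rightarrow> node_state" where
  "grid_step n d x =
     (if \<exists>e. sole_contact n d e then contact (THE e. sole_contact n d e) x else x)"

primrec grid_chain ::
    "nat \<Rightarrow> (nat \<Rightarrow> node_state) \<Rightarrow> (nat \<Rightarrow> nat set \<Rightarrow> nat) \<Rightarrow> nat \<Rightarrow> nat \<Rightarrow> node_state" where
  "grid_chain n x0 d 0 = x0"
| "grid_chain n x0 d (Suc i) = grid_step n (d i) (grid_chain n x0 d i)"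

lemma sole_contact_unique: "sole_contact n d e \<Longrightarrow> sole_contact n d e' \<Longrightarrow> e' = e"
proof -
  assume "sole_contact n d e" "sole_contact n d e'"
  then have "of_bool (e' = e) = (1 :: nat)" unfolding sole_contact_def by fastforce
  then show "e' = e" by (simp add: of_bool_def split: if_splits)
qed

lemma grid_step_sole: "sole_contact n d e \<Longrightarrow> grid_step n d x = contact e x"
proof -
  assume e: "sole_contact n d e"
  then have "(THE e. sole_contact n d e) = e"
    using sole_contact_unique by (intro the_equality) auto
  then show ?thesis using e by (auto simp: grid_step_def)
qed

lemma grid_step_cases:
  obtains e where "sole_contact n d e" "grid_step n d x = contact e x" | "grid_step n d x = x"
proof (cases "\<exists>e. sole_contact n d e")
  case True
  then show ?thesis using grid_step_sole that(1) by blast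
next
  case False
  then show ?thesis using that(2) by (simp add: grid_step_def)
qed

text \<open>
  This form separates the configuration from the contacts that act on it, so that independence
  of the two can be used summand by summand.
\<close>

lemma grid_step_increment:
  fixes g :: "(nat \<Rightarrow> node_state) \<Rightarrow> real"
  shows "g (grid_step n d x) - g x
    = (\<Sum>e\<in>node_pairs n. (g (contact e x) - g x) * of_bool (sole_contact n d e))"
proof (cases "\<exists>e. sole_contact n d e")
  case True
  then obtain e where e: "sole_contact n d e" by blast
  have iff: "sole_contact n d e' \<longleftrightarrow> e' = e" for e'
    using sole_contact_unique[OF e, of e'] e by blast
  have "(\<Sum>e'\<in>node_pairs n. (g (contact e' x) - g x) * of_bool (sole_contact n d e'))
      = (\<Sum>e'\<in>node_pairs n. if e' = e then g (contact e x) - g x else 0)"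
    unfolding iff by (intro sum.cong) auto
  moreover have "e \<in> node_pairs n" using e by (simp add: sole_contact_def)
  ultimately show ?thesis by (simp add: grid_step_sole[OF e])
qed (simp add: grid_step_def)

lemma sole_contact_cong:
  "(\<And>e. e \<in> node_pairs n \<Longrightarrow> d e = d' e) \<Longrightarrow> sole_contact n d e = sole_contact n d' e"
  by (simp add: sole_contact_def)

text \<open>
  The state after \<open>i\<close> steps is a function of the first \<open>i\<close> intervals only; this makes it
  independent of the contacts in the next interval.
\<close>

lemma grid_chain_cong:
  "(\<And>j e. j < i \<Longrightarrow> e \<in> node_pairs n \<Longrightarrow> d j e = d' j e)
    \<Longrightarrow> grid_chain n x0 d i = grid_chain n x0 d' i"
proof (induction i)
  case (Suc i)
  have "sole_contact n (d i) = sole_contact n (d' i)"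
    by (intro ext sole_contact_cong Suc.prems) simp_all
  moreover have "grid_chain n x0 d i = grid_chain n x0 d' i"
    by (intro Suc.IH Suc.prems) simp_all
  ultimately show ?case by (simp only: grid_step_def grid_chain.simps)
qed simp

lemma grid_step_cong:
  assumes "\<And>k. k \<in> {1..n} \<Longrightarrow> x k = y k" "k \<in> {1..n}"
  shows "grid_step n d x k = grid_step n d y k"
proof (cases "\<exists>e. sole_contact n d e")
  case True
  then obtain e where e: "sole_contact n d e" by blast
  then have "e \<in> node_pairs n" by (simp add: sole_contact_def)
  from contact_cong[OF this assms] show ?thesis
    by (simp add: grid_step_sole[OF e])
qed (use assms in \<open>simp add: grid_step_def\<close>)

lemma initial_count_grid_step_le:
  "initial_count n (grid_step n d x) St1 \<le> initial_count n x St1"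
proof (rule grid_step_cases[of n d x])
  fix e assume "sole_contact n d e" "grid_step n d x = contact e x"
  then show ?thesis
    using initial_count_contact[of e n St1 x] by (simp add: sole_contact_def)
qed simp

lemma initial_count_diff_grid_step:
  assumes "initial_count n x St0 = initial_count n x St1 + D"
  shows "initial_count n (grid_step n d x) St0 = initial_count n (grid_step n d x) St1 + D"
proof (rule grid_step_cases[of n d x])
  fix e assume "sole_contact n d e" "grid_step n d x = contact e x"
  then show ?thesis
    using initial_count_contact[of e n St0 x] initial_count_contact[of e n St1 x] assms
    by (auto simp: sole_contact_def)
qed (use assms in simp)

lemma initial_count_diff_grid_chain:
  "initial_count n x0 St0 = initial_count n x0 St1 + D \<Longrightarrow>
    initial_count n (grid_chain n x0 d i) St0 = initial_count n (grid_chain n x0 d i) St1 + D"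
  by (induction i) (simp_all only: grid_chain.simps initial_count_diff_grid_step)

lemma decseq_initial_count_grid_chain:
  "decseq (\<lambda>i. initial_count n (grid_chain n x0 d i) St1)"
  by (rule decseq_SucI) (simp add: initial_count_grid_step_le)

section \<open>Trajectories on the time grid\<close>

locale complete_graph_consensus = interval_consensus M n "complete_graph_rate n" x0 N X
  for M :: "'w measure" and n x0 N X +
  assumes two_nodes: "1 < n"
begin

text \<open>
  The outcomes at which the update rule holds at every time; almost every outcome is one.
\<close>

definition regular :: "'w \<Rightarrow> bool" where
  "regular \<omega> \<longleftrightarrow> \<omega> \<in> space M \<and> (\<forall>t>0. \<exists>x.
     (\<forall>i\<in>{1..n}. \<forall>\<^sub>F s in at_left t. X s \<omega> i = x i) \<and>
     (\<forall>i\<in>{1..n}. \<forall>j\<in>{1..n}. i \<noteq> j \<and> jumps_at (\<lambda>s. N {i, j} s \<omega>) t \<longrightarrow>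
        (\<forall>k\<in>{1..n}. X t \<omega> k = meet i j x k)) \<and>
     ((\<forall>e\<in>node_pairs n. \<not> jumps_at (\<lambda>s. N e s \<omega>) t) \<longrightarrow>
        (\<forall>k\<in>{1..n}. X t \<omega> k = x k)))"

lemma AE_regular: "AE \<omega> in M. regular \<omega>"
  using dynamics AE_space by eventually_elim (simp add: regular_def)

lemma regularE:
  assumes "regular \<omega>" "0 < t"
  obtains x where "\<forall>i\<in>{1..n}. \<forall>\<^sub>F s in at_left t. X s \<omega> i = x i"
    and "\<forall>i\<in>{1..n}. \<forall>j\<in>{1..n}. i \<noteq> j \<and> jumps_at (\<lambda>s. N {i, j} s \<omega>) t \<longrightarrow>
      (\<forall>k\<in>{1..n}. X t \<omega> k = meet i j x k)"
    and "(\<forall>e\<in>node_pairs n. \<not> jumps_at (\<lambda>s. N e s \<omega>) t) \<longrightarrow> (\<forall>k\<in>{1..n}. X t \<omega> k = x k)"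
  using assms(1)[unfolded regular_def, THEN conjunct2, THEN spec, THEN mp, OF assms(2)]
  by (elim exE conjE) (rule that)

definition rate :: real where "rate = 1 / (real n - 1)"

lemma poisson_pair: "e \<in> node_pairs n \<Longrightarrow> poisson_process rate (N e)"
proof -
  assume "e \<in> node_pairs n"
  then obtain i j where "e = {i, j}" "i \<in> {1..n}" "j \<in> {1..n}" "i \<noteq> j"
    by (auto simp: node_pairs_def)
  then show ?thesis
    using contacts_poisson[of i j] by (simp add: complete_graph_rate_def rate_def)
qed

lemma counting_path:
  assumes "e \<in> node_pairs n" "\<omega> \<in> space M"
  shows "mono_on {0..} (\<lambda>t. N e t \<omega>)" "0 \<le> t \<Longrightarrow> \<forall>\<^sub>F s in at_right t. N e s \<omega> = N e t \<omega>"
  using poisson_pair[OF assms(1)] assms(2) by (auto simp: poisson_process_def)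

lemma quiet_interval:
  assumes "regular \<omega>" "0 \<le> a" "a \<le> b" "k \<in> {1..n}"
    and quiet: "\<And>t e. a < t \<Longrightarrow> t \<le> b \<Longrightarrow> e \<in> node_pairs n \<Longrightarrow> \<not> jumps_at (\<lambda>s. N e s \<omega>) t"
  shows "X b \<omega> k = X a \<omega> k"
proof (rule constant_on_Icc[OF \<open>a \<le> b\<close>])
  fix t assume "a \<le> t" "t < b"
  then show "\<forall>\<^sub>F s in at_right t. X s \<omega> k = X t \<omega> k"
    using assms by (intro right_continuous) (auto simp: regular_def)
next
  fix t assume t: "a < t" "t \<le> b"
  then have "0 < t" using assms(2) by simp
  then obtain x
    where x: "\<forall>i\<in>{1..n}. \<forall>\<^sub>F s in at_left t. X s \<omega> i = x i"
      "(\<forall>e\<in>node_pairs n. \<not> jumps_at (\<lambda>s. N e s \<omega>) t) \<longrightarrow> (\<forall>k\<in>{1..n}. X t \<omega> k = x k)"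
    by (rule regularE[OF assms(1)])
  have "X t \<omega> k = x k" using x(2) quiet[OF t] \<open>k \<in> {1..n}\<close> by simp
  then show "\<forall>\<^sub>F s in at_left t. X s \<omega> k = X t \<omega> k"
    using x(1) \<open>k \<in> {1..n}\<close> by simp
qed

text \<open>
  The trajectory is constant before and after the only jump time \<open>\<tau>\<close>. Its left limit at \<open>\<tau>\<close> is
  therefore the configuration at \<open>a\<close>, and this is the configuration that the contact updates.
\<close>

lemma single_jump_interval:
  assumes reg: "regular \<omega>" and e: "e \<in> node_pairs n"
    and \<tau>: "0 \<le> a" "a < \<tau>" "\<tau> \<le> b" "jumps_at (\<lambda>s. N e s \<omega>) \<tau>"
    and only: "\<And>t e'. a < t \<Longrightarrow> t \<le> b \<Longrightarrow> e' \<in> node_pairs n \<Longrightarrow>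
      jumps_at (\<lambda>s. N e' s \<omega>) t \<Longrightarrow> t = \<tau>"
    and s: "a \<le> s" "s \<le> b" and k: "k \<in> {1..n}"
  shows "X s \<omega> k = (if s < \<tau> then X a \<omega> k else contact e (X a \<omega>) k)"
proof -
  have before: "X s \<omega> k = X a \<omega> k" if "a \<le> s" "s < \<tau>" "k \<in> {1..n}" for s k
  proof (rule quiet_interval[OF reg \<tau>(1) that(1,3)])
    show "\<not> jumps_at (\<lambda>s. N e s \<omega>) t" if "a < t" "t \<le> s" "e \<in> node_pairs n" for t e
      using only[of t e] that \<tau>(3) \<open>s < \<tau>\<close> by auto
  qed
  show ?thesis
  proof (cases "s < \<tau>")
    case False
    obtain i j where ij: "e = {i, j}" "i \<in> {1..n}" "j \<in> {1..n}" "i \<noteq> j"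
      using e by (auto simp: node_pairs_def)
    have "0 < \<tau>" using \<tau> by simp
    then obtain x where x: "\<forall>k\<in>{1..n}. \<forall>\<^sub>F s in at_left \<tau>. X s \<omega> k = x k"
        "\<forall>i\<in>{1..n}. \<forall>j\<in>{1..n}. i \<noteq> j \<and> jumps_at (\<lambda>s. N {i, j} s \<omega>) \<tau> \<longrightarrow>
          (\<forall>k\<in>{1..n}. X \<tau> \<omega> k = meet i j x k)"
      by (rule regularE[OF reg])
    \<comment> \<open>The left limit at \<open>\<tau>\<close> is the constant value before \<open>\<tau>\<close>.\<close>
    have x_eq: "x k = X a \<omega> k" if k: "k \<in> {1..n}" for k
    proof -
      have "\<forall>\<^sub>F s in at_left \<tau>. X s \<omega> k = x k" using x(1) k by blast
      moreover have "\<forall>\<^sub>F s in at_left \<tau>. s \<in> {a<..<\<tau>}"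
        using \<tau>(2) by (rule eventually_at_left_real)
      ultimately have "\<forall>\<^sub>F s in at_left \<tau>. x k = X a \<omega> k"
      proof eventually_elim
        case (elim s)
        then show ?case using before[of s k] k by simp
      qed
      then show ?thesis by simp
    qed
    have "X s \<omega> k = X \<tau> \<omega> k"
    proof (rule quiet_interval[OF reg _ _ k])
      show "\<not> jumps_at (\<lambda>s. N e s \<omega>) t" if "\<tau> < t" "t \<le> s" "e \<in> node_pairs n" for t e
        using only[of t e] that \<tau>(2) s(2) by auto
    qed (use False \<tau> in auto)
    also have "\<dots> = contact e x k"
      using x(2) ij \<tau>(4) k by (simp add: contact_pair)
    also have "\<dots> = contact e (X a \<omega>) k"
      using contact_cong[OF e x_eq k] by simp
    finally show ?thesis using False by simp
  qed (use before[OF s(1) _ k] in simp)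
qed

text \<open>
  The second claim excludes intermediate configurations. It is needed because the duration refers
  to all times and not only to grid points.
\<close>

lemma at_most_one_contact_interval:
  assumes reg: "regular \<omega>" and ab: "0 \<le> a" "a \<le> b"
  defines "d \<equiv> \<lambda>e. N e b \<omega> - N e a \<omega>"
  assumes few: "(\<Sum>e\<in>node_pairs n. d e) \<le> 1"
  shows "\<And>k. k \<in> {1..n} \<Longrightarrow> X b \<omega> k = grid_step n d (X a \<omega>) k"
    and "\<And>s. a \<le> s \<Longrightarrow> s \<le> b \<Longrightarrow>
      (\<forall>k\<in>{1..n}. X s \<omega> k = X a \<omega> k) \<or> (\<forall>k\<in>{1..n}. X s \<omega> k = X b \<omega> k)"
proof -
  have \<omega>: "\<omega> \<in> space M" using reg by (simp add: regular_def)
  have incr: "N e b \<omega> = N e a \<omega> + d e" if "e \<in> node_pairs n" for e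
    using mono_onD[OF counting_path(1)[OF that \<omega>], of a b] ab by (simp add: d_def)
  have no_jump: "\<not> jumps_at (\<lambda>s. N e s \<omega>) t"
    if "e \<in> node_pairs n" "d e = 0" "a < t" "t \<le> b" for e t
    using no_jump_if_no_increment[OF counting_path(1)[OF that(1) \<omega>], of a t b] incr that ab
    by simp
  have "(\<forall>k\<in>{1..n}. X b \<omega> k = grid_step n d (X a \<omega>) k) \<and>
    (\<forall>s. a \<le> s \<longrightarrow> s \<le> b \<longrightarrow>
      (\<forall>k\<in>{1..n}. X s \<omega> k = X a \<omega> k) \<or> (\<forall>k\<in>{1..n}. X s \<omega> k = X b \<omega> k))"
  proof (cases "\<forall>e\<in>node_pairs n. d e = 0")
    case True
    then have X_s: "X s \<omega> k = X a \<omega> k" if "a \<le> s" "s \<le> b" "k \<in> {1..n}" for s k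
      using that ab no_jump by (intro quiet_interval[OF reg]) auto
    have "\<not> (\<exists>e. sole_contact n d e)"
      using True by (auto simp: sole_contact_def)
    then have "grid_step n d (X a \<omega>) = X a \<omega>" by (simp add: grid_step_def)
    then show ?thesis
      using X_s[OF ab(2) order_refl] by (intro conjI ballI allI impI disjI1 X_s) simp_all
  next
    case False
    then obtain e where e: "e \<in> node_pairs n" "d e \<noteq> 0" by blast
    have "d e + (\<Sum>e'\<in>node_pairs n - {e}. d e') \<le> 1"
      using few e by (subst (asm) sum.remove[of _ e]) auto
    then have de: "d e = 1" and "(\<Sum>e'\<in>node_pairs n - {e}. d e') = 0"
      using e(2) by linarith+
    then have others: "\<forall>e'\<in>node_pairs n - {e}. d e' = 0"
      by simp
    then have sole: "sole_contact n d e"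
      using e de by (auto simp: sole_contact_def)
    have "N e b \<omega> = Suc (N e a \<omega>)" using incr[OF e(1)] de by simp
    then have "\<exists>!\<tau>. a < \<tau> \<and> \<tau> \<le> b \<and> jumps_at (\<lambda>s. N e s \<omega>) \<tau>"
      by (intro unique_jump_if_unit_increment counting_path e(1) \<omega> ab)
    then obtain \<tau> where \<tau>: "a < \<tau>" "\<tau> \<le> b" "jumps_at (\<lambda>s. N e s \<omega>) \<tau>"
      and only: "\<And>\<sigma>. a < \<sigma> \<Longrightarrow> \<sigma> \<le> b \<Longrightarrow> jumps_at (\<lambda>s. N e s \<omega>) \<sigma> \<Longrightarrow> \<sigma> = \<tau>"
      unfolding Ex1_def by blast
    have X_s: "X s \<omega> k = (if s < \<tau> then X a \<omega> k else contact e (X a \<omega>) k)"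
      if "a \<le> s" "s \<le> b" "k \<in> {1..n}" for s k
    proof (rule single_jump_interval[OF reg e(1) ab(1) \<tau>(1-3) _ that])
      fix t e' assume "a < t" "t \<le> b" "e' \<in> node_pairs n" "jumps_at (\<lambda>s. N e' s \<omega>) t"
      then show "t = \<tau>" 
        using others no_jump[of e' t] only[of t] by (cases "e' = e") auto
    qed
    show ?thesis
    proof (intro conjI ballI allI impI)
      show "X b \<omega> k = grid_step n d (X a \<omega>) k" if "k \<in> {1..n}" for k
        using X_s[of b k] that \<tau>(2) ab by (simp add: grid_step_sole[OF sole])
      show "(\<forall>k\<in>{1..n}. X s \<omega> k = X a \<omega> k) \<or> (\<forall>k\<in>{1..n}. X s \<omega> k = X b \<omega> k)"
        if "a \<le> s" "s \<le> b" for s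
        using X_s[OF that] X_s[of b] \<tau>(2) ab by (cases "s < \<tau>") simp_all
    qed
  qed
  then show "\<And>k. k \<in> {1..n} \<Longrightarrow> X b \<omega> k = grid_step n d (X a \<omega>) k"
    and "\<And>s. a \<le> s \<Longrightarrow> s \<le> b \<Longrightarrow>
      (\<forall>k\<in>{1..n}. X s \<omega> k = X a \<omega> k) \<or> (\<forall>k\<in>{1..n}. X s \<omega> k = X b \<omega> k)"
    by blast+
qed

definition increments :: "real \<Rightarrow> 'w \<Rightarrow> nat \<Rightarrow> nat set \<Rightarrow> nat" where
  "increments h \<omega> i e = N e (h * real (Suc i)) \<omega> - N e (h * real i) \<omega>"

definition grid :: "real \<Rightarrow> 'w \<Rightarrow> nat \<Rightarrow> nat \<Rightarrow> node_state" where
  "grid h \<omega> = grid_chain n x0 (increments h \<omega>)"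

text \<open>
  The mesh \<open>h\<close> separates all contacts of the first \<open>m\<close> intervals.
\<close>

definition resolved :: "real \<Rightarrow> nat \<Rightarrow> 'w \<Rightarrow> bool" where
  "resolved h m \<omega> \<longleftrightarrow> (\<forall>i<m. (\<Sum>e\<in>node_pairs n. increments h \<omega> i e) \<le> 1)"

lemma grid_agrees:
  assumes "regular \<omega>" "0 \<le> h" "resolved h m \<omega>"
  shows "i \<le> m \<Longrightarrow> k \<in> {1..n} \<Longrightarrow> X (h * real i) \<omega> k = grid h \<omega> i k"
proof (induction i arbitrary: k)
  case 0
  then show ?case
    using assms(1) initial_state by (simp add: grid_def regular_def)
next
  case (Suc i)
  have "X (h * real (Suc i)) \<omega> k = grid_step n (increments h \<omega> i) (X (h * real i) \<omega>) k"
    using at_most_one_contact_interval(1)[OF assms(1), of "h * real i" "h * real (Suc i)" k]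
      assms Suc.prems by (simp add: resolved_def increments_def[abs_def] mult_left_mono)
  also have "\<dots> = grid h \<omega> (Suc i) k"
    using Suc by (simp add: grid_def) (rule grid_step_cong, auto)
  finally show ?case .
qed

text \<open>
  A configuration without ones at an arbitrary time is also the configuration at an end point of
  its grid interval, and along the chain the number of ones never increases.
\<close>

lemma ones_gone_after:
  assumes "regular \<omega>" "0 < h" "resolved h m \<omega>" "i \<le> m"
    and s: "0 \<le> s" "s \<le> h * real i" "\<forall>k\<in>{1..n}. X s \<omega> k \<noteq> St1"
  shows "initial_count n (grid h \<omega> i) St1 = 0"
proof -
  note agrees = grid_agrees[OF assms(1) less_imp_le[OF assms(2)] assms(3)]
  have dec: "initial_count n (grid h \<omega> j') St1 \<le> initial_count n (grid h \<omega> j) St1"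
    if "j \<le> j'" for j j'
    using decseqD[OF decseq_initial_count_grid_chain that] by (simp add: grid_def)
  have zero: "initial_count n (grid h \<omega> j) St1 = 0"
    if "j \<le> m" "\<forall>k\<in>{1..n}. X s \<omega> k = X (h * real j) \<omega> k" for j
    using that s(3) agrees[of j] by (auto simp: initial_count_eq_0_iff)
  show ?thesis
  proof (cases "s = h * real i")
    case True
    then show ?thesis using zero assms(4) by simp
  next
    case False
    define j where "j = nat \<lfloor>s / h\<rfloor>"
    have j: "real j \<le> s / h" "s / h < real j + 1"
      using s(1) assms(2) by (simp_all add: j_def)
    have js: "h * real j \<le> s" "s \<le> h * real (Suc j)"
      using j assms(2) by (simp_all add: field_simps)
    \<comment> \<open>\<open>s\<close> lies strictly before grid point \<open>i\<close>, so its interval \<open>j\<close> ends at grid point \<open>i\<close> at the latest.\<close>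
    have "h * real j < h * real i" using js(1) s(2) False by simp
    then have "Suc j \<le> i" using assms(2) by simp
    then have "(\<forall>k\<in>{1..n}. X s \<omega> k = X (h * real j) \<omega> k) \<or>
        (\<forall>k\<in>{1..n}. X s \<omega> k = X (h * real (Suc j)) \<omega> k)"
      using at_most_one_contact_interval(2)[OF assms(1) _ _ _ js] assms(2,3,4)
      by (simp add: resolved_def increments_def)
    then have "initial_count n (grid h \<omega> j) St1 = 0 \<or> initial_count n (grid h \<omega> (Suc j)) St1 = 0"
      using zero[of j] zero[of "Suc j"] \<open>Suc j \<le> i\<close> assms(4) by auto
    then show ?thesis
      using dec[of j i] dec[of "Suc j" i] \<open>Suc j \<le> i\<close> by auto
  qed
qed

text \<open>
  The grid points with a one left form an initial segment of length \<open>L\<close>, and the truncated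
  duration lies between \<open>h * (L - 1)\<close> and \<open>h * L\<close>.
\<close>

lemma duration_grid_approx:
  assumes "regular \<omega>" "0 < h" "resolved h m \<omega>"
  shows "\<bar>enn2real (min (first_phase_duration n X \<omega>) (ennreal (h * real m)))
      - h * (\<Sum>i<m. of_bool (0 < initial_count n (grid h \<omega> i) St1))\<bar> \<le> h"
proof -
  define c where "c i = initial_count n (grid h \<omega> i) St1" for i
  \<comment> \<open>The disjunct \<open>i = m\<close> covers the case that a one is left at every grid point before \<open>m\<close>.\<close>
  define L where "L = (LEAST i. i = m \<or> c i = 0)"
  have dec: "c j \<le> c i" if "i \<le> j" for i j
    using decseqD[OF decseq_initial_count_grid_chain that] by (simp add: c_def grid_def)
  have L: "L = m \<or> c L = 0" unfolding L_def by (rule LeastI[of _ m]) simp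
  have "L \<le> m" unfolding L_def by (rule Least_le) simp
  have below_L: "0 < c i" if "i < L" for i
    using not_less_Least[of i "\<lambda>i. i = m \<or> c i = 0"] that by (simp add: L_def)
  have pos_iff: "0 < c i \<longleftrightarrow> i < L" if "i < m" for i
    using below_L L dec[of L i] that by (cases "i < L") auto
  have "(\<Sum>i<m. of_bool (0 < c i)) = (\<Sum>i<m. of_bool (i < L) :: real)"
    by (intro sum.cong) (auto simp: pos_iff)
  also have "\<dots> = (\<Sum>i<L. 1)"
    using \<open>L \<le> m\<close> by (intro sum.mono_neutral_cong_right) auto
  finally have count: "(\<Sum>i<m. of_bool (0 < c i)) = real L" by simp
  let ?T = "min (first_phase_duration n X \<omega>) (ennreal (h * real m))"
  have upper: "?T \<le> ennreal (h * real L)"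
  proof (cases "L = m")
    case False
    then have "c L = 0" using L by simp
    then have "\<forall>k\<in>{1..n}. X (h * real L) \<omega> k \<noteq> St1"
      using grid_agrees[OF assms(1) less_imp_le[OF assms(2)] assms(3) \<open>L \<le> m\<close>]
      by (auto simp: c_def initial_count_eq_0_iff)
    then have "first_phase_duration n X \<omega> \<le> ennreal (h * real L)"
      unfolding first_phase_duration_def using assms(2) by (intro INF_lower) simp
    then show ?thesis by (rule min.coboundedI1)
  qed simp
  have lower: "ennreal (h * real (L - 1)) \<le> ?T"
  proof (intro min.boundedI)
    show "ennreal (h * real (L - 1)) \<le> first_phase_duration n X \<omega>"
      unfolding first_phase_duration_def
    proof (rule INF_greatest)
      fix t assume t: "t \<in> {t. 0 \<le> t \<and> (\<forall>i\<in>{1..n}. X t \<omega> i \<noteq> St1)}"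
      show "ennreal (h * real (L - 1)) \<le> ennreal t"
      proof (rule ennreal_leI, rule ccontr)
        assume "\<not> h * real (L - 1) \<le> t"
        then have "t \<le> h * real (L - 1)" "0 < L - 1" using t by (cases "L - 1 = 0"; simp)+
        then have "c (L - 1) = 0"
          using ones_gone_after[OF assms, of "L - 1" t] t \<open>L \<le> m\<close> by (simp add: c_def)
        then show False using below_L[of "L - 1"] \<open>0 < L - 1\<close> by simp
      qed
    qed
    show "ennreal (h * real (L - 1)) \<le> ennreal (h * real m)"
      using \<open>L \<le> m\<close> assms(2) by (intro ennreal_leI mult_left_mono) auto
  qed
  have "enn2real ?T \<le> h * real L"
    using upper assms(2) by (simp add: enn2real_leI)
  moreover have "h * real (L - 1) \<le> enn2real ?T"
    using enn2real_mono[OF lower] assms(2) by (simp add: min_less_iff_disj)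
  moreover have "h * real L - h \<le> h * real (L - 1)"
    using assms(2) by (cases L) (auto simp: algebra_simps)
  moreover have "h * (\<Sum>i<m. of_bool (0 < initial_count n (grid h \<omega> i) St1)) = h * real L"
    using count by (simp add: c_def)
  ultimately show ?thesis using assms(2) by (simp add: abs_le_iff)
qed

section \<open>Measurability of the duration\<close>

text \<open>
  The infimum over uncountably many times equals the infimum over the rational ones among them:
  by right continuity, a time without ones is followed by an interval without ones.
\<close>

lemma first_phase_duration_measurable: "first_phase_duration n X \<in> borel_measurable M"
proof -
  define P where "P t \<omega> \<longleftrightarrow> (\<forall>i\<in>{1..n}. X t \<omega> i \<noteq> St1)" for t \<omega>
  let ?Q = "\<rat> \<inter> {0..} :: real set"
  let ?f = "\<lambda>q \<omega>. if P q \<omega> then ennreal q else top"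
  have "first_phase_duration n X \<omega> = (INF q\<in>?Q. ?f q \<omega>)" if \<omega>: "\<omega> \<in> space M" for \<omega>
  proof (rule antisym)
    show "first_phase_duration n X \<omega> \<le> (INF q\<in>?Q. ?f q \<omega>)"
      unfolding first_phase_duration_def
      by (rule INF_greatest) (auto simp: P_def intro!: INF_lower)
    show "(INF q\<in>?Q. ?f q \<omega>) \<le> first_phase_duration n X \<omega>"
      unfolding first_phase_duration_def
    proof (rule INF_greatest, rule dense_ge)
      fix t y assume t: "t \<in> {t. 0 \<le> t \<and> (\<forall>i\<in>{1..n}. X t \<omega> i \<noteq> St1)}" and y: "ennreal t < y"
      then have t0: "0 \<le> t" and Pt: "P t \<omega>" by (auto simp: P_def)
      have "\<forall>\<^sub>F s in at_right t. \<forall>i\<in>{1..n}. X s \<omega> i = X t \<omega> i"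
        using right_continuous[OF \<omega> t0] by (intro eventually_ball_finite) auto
      then obtain b where b: "t < b" "\<And>s. t < s \<Longrightarrow> s < b \<Longrightarrow> P s \<omega>"
        unfolding eventually_at_right_field using Pt by (auto simp: P_def)
      obtain y' where y': "t < y'" "ennreal y' \<le> y"
      proof (cases y)
        case (real r)
        then show ?thesis using y t0 that[of r] by (simp add: ennreal_less_iff)
      next
        case top
        then show ?thesis using that[of "t + 1"] by simp
      qed
      obtain q where q: "q \<in> \<rat>" "t < q" "q < min b y'"
        using Rats_dense_in_real[of t "min b y'"] b y' by auto
      have "(INF q\<in>?Q. ?f q \<omega>) \<le> ?f q \<omega>"
        using q t0 by (intro INF_lower) auto
      also have "\<dots> = ennreal q" using b(2) q by simp
      also have "\<dots> \<le> ennreal y'" using q by (intro ennreal_leI) auto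
      also have "\<dots> \<le> y" by (rule y')
      finally show "(INF q\<in>?Q. ?f q \<omega>) \<le> y" .
    qed
  qed
  moreover have "(\<lambda>\<omega>. INF q\<in>?Q. ?f q \<omega>) \<in> borel_measurable M"
  proof (rule borel_measurable_INF)
    show "countable ?Q" using countable_rat by (rule countable_Int1)
    fix q assume q: "q \<in> ?Q"
    have "Measurable.pred M (P q)"
      unfolding P_def
    proof (rule pred_intros_finite)
      fix i assume "i \<in> {1..n}"
      then have [measurable]: "(\<lambda>\<omega>. X q \<omega> i) \<in> M \<rightarrow>\<^sub>M count_space UNIV"
        using q by (intro state_measurable) auto
      show "Measurable.pred M (\<lambda>\<omega>. X q \<omega> i \<noteq> St1)" by measurable
    qed simp
    then show "?f q \<in> borel_measurable M" by measurable
  qed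
  ultimately show ?thesis by (simp cong: measurable_cong)
qed

end

section \<open>Contact counts in the grid intervals\<close>

text \<open>
  The probability that a Poisson variable of mean \<open>x\<close> exceeds one is of second order.
\<close>

lemma one_minus_exp_le_square:
  fixes x :: real
  assumes "0 \<le> x"
  shows "1 - (1 + x) * exp (- x) \<le> x\<^sup>2"
proof -
  have "(1 + x) * (1 + - x) \<le> (1 + x) * exp (- x)"
    using assms by (intro mult_left_mono exp_ge_add_one_self) auto
  then show ?thesis by (simp add: algebra_simps power2_eq_square)
qed

context complete_graph_consensus
begin

lemma rate_pos: "0 < rate"
  using two_nodes by (simp add: rate_def)

lemma node_pairs_nonempty: "node_pairs n \<noteq> {}"
proof -
  have "{1, 2} \<in> node_pairs n"
    unfolding node_pairs_def mem_Collect_eq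
    by (rule exI[of _ 1], rule exI[of _ 2]) (use two_nodes in simp)
  then show ?thesis by blast
qed

definition total_rate :: real where
  "total_rate = rate * real (card (node_pairs n))"

text \<open>
  Independence between pairs is given for whole paths, independence over time for each pair
  separately.
\<close>

lemma increments_indep:
  assumes "0 \<le> h"
  shows "indep_vars (\<lambda>_. count_space UNIV) (\<lambda>(e, i) \<omega>. increments h \<omega> i e) (node_pairs n \<times> UNIV)"
proof (rule indep_vars_Times[where X = "\<lambda>e i \<omega>. increments h \<omega> i e"])
  let ?D = "\<lambda>f. \<lambda>i\<in>UNIV. f (h * real (Suc i)) - f (h * real i) :: nat"
  have "indep_vars (\<lambda>_. PiM UNIV (\<lambda>_. count_space UNIV)) (\<lambda>e \<omega>. ?D (\<lambda>t\<in>{0..}. N e t \<omega>)) (node_pairs n)"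
  proof (rule indep_vars_compose2[OF contacts_indep])
    show "?D \<in> PiM {0..} (\<lambda>_. count_space UNIV) \<rightarrow>\<^sub>M PiM UNIV (\<lambda>_. count_space UNIV)"
    proof (rule measurable_restrict)
      fix i :: nat
      have component: "(\<lambda>f :: real \<Rightarrow> nat. f (h * real j)) \<in> PiM {0..} (\<lambda>_. count_space UNIV) \<rightarrow>\<^sub>M count_space UNIV" for j
        using assms by (intro measurable_component_singleton) auto
      show "(\<lambda>f. f (h * real (Suc i)) - f (h * real i) :: nat)
          \<in> PiM {0..} (\<lambda>_. count_space UNIV) \<rightarrow>\<^sub>M count_space UNIV"
        by (rule measurable_compose_countable[OF measurable_compose[OF component] component]) simp
    qed
  qed
  also have "(\<lambda>e \<omega>. ?D (\<lambda>t\<in>{0..}. N e t \<omega>)) = (\<lambda>e \<omega>. \<lambda>i\<in>UNIV. increments h \<omega> i e)"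
    using assms by (simp add: increments_def fun_eq_iff)
  finally show "indep_vars (\<lambda>_. PiM UNIV (\<lambda>_. count_space UNIV))
      (\<lambda>e \<omega>. \<lambda>i\<in>UNIV. increments h \<omega> i e) (node_pairs n)" .
next
  fix e assume "e \<in> node_pairs n"
  have "mono (\<lambda>i. h * real i)" using assms by (auto intro!: monoI mult_left_mono)
  then show "indep_vars (\<lambda>_. count_space UNIV) (\<lambda>i \<omega>. increments h \<omega> i e) UNIV"
    using poisson_pair[OF \<open>e \<in> node_pairs n\<close>] unfolding poisson_process_def increments_def
    by (elim conjE allE[of _ "\<lambda>i. h * real i"]) simp
qed

lemma prob_increments:
  assumes "0 \<le> h"
  shows "prob {\<omega> \<in> space M. \<forall>e\<in>node_pairs n. increments h \<omega> i e = v e}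
    = (\<Prod>e\<in>node_pairs n. exp (- (rate * h)) * (rate * h) ^ v e / fact (v e))"
proof -
  let ?X = "\<lambda>(e, i) \<omega>. increments h \<omega> i e"
  let ?J = "node_pairs n \<times> {i}"
  have "{\<omega> \<in> space M. \<forall>e\<in>node_pairs n. increments h \<omega> i e = v e}
      = (\<Inter>j\<in>?J. ?X j -` {v (fst j)} \<inter> space M)"
    using node_pairs_nonempty by auto
  also have "prob \<dots> = (\<Prod>j\<in>?J. prob (?X j -` {v (fst j)} \<inter> space M))"
    using node_pairs_nonempty by (intro indep_varsD[OF increments_indep[OF assms]]) auto
  also have "\<dots> = (\<Prod>e\<in>node_pairs n. prob (?X (e, i) -` {v e} \<inter> space M))"
    by (rule prod.reindex_bij_witness[of _ "\<lambda>e. (e, i)" fst]) auto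
  also have "\<dots> = (\<Prod>e\<in>node_pairs n. exp (- (rate * h)) * (rate * h) ^ v e / fact (v e))"
  proof (rule prod.cong[OF refl])
    fix e assume e: "e \<in> node_pairs n"
    have "prob {\<omega> \<in> space M. N e (h * real (Suc i)) \<omega> - N e (h * real i) \<omega> = v e}
        = exp (- (rate * (h * real (Suc i) - h * real i)))
          * (rate * (h * real (Suc i) - h * real i)) ^ v e / fact (v e)"
      using poisson_pair[OF e] assms unfolding poisson_process_def by (auto simp: mult_left_mono)
    moreover have "h * real (Suc i) - h * real i = h" by (simp add: algebra_simps)
    moreover have "{\<omega> \<in> space M. N e (h * real (Suc i)) \<omega> - N e (h * real i) \<omega> = v e}
        = ?X (e, i) -` {v e} \<inter> space M"
      by (auto simp: increments_def)
    ultimately show "prob (?X (e, i) -` {v e} \<inter> space M)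
        = exp (- (rate * h)) * (rate * h) ^ v e / fact (v e)"
      by simp
  qed
  finally show ?thesis .
qed

lemma prob_no_contact:
  assumes "0 \<le> h"
  shows "prob {\<omega> \<in> space M. \<forall>e\<in>node_pairs n. increments h \<omega> i e = 0} = exp (- (total_rate * h))"
  using prob_increments[OF assms, of i "\<lambda>_. 0"]
  by (simp add: total_rate_def mult_ac flip: exp_of_nat_mult)

lemma prob_sole_contact:
  assumes "0 \<le> h" "e \<in> node_pairs n"
  shows "prob {\<omega> \<in> space M. sole_contact n (increments h \<omega> i) e}
    = exp (- (total_rate * h)) * (rate * h)"
proof -
  let ?w = "\<lambda>e'. (rate * h) ^ of_bool (e' = e) / fact (of_bool (e' = e)) :: real"
  have "prob {\<omega> \<in> space M. sole_contact n (increments h \<omega> i) e}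
      = (\<Prod>e'\<in>node_pairs n. exp (- (rate * h)) * ?w e')"
    using prob_increments[OF assms(1), of i "\<lambda>e'. of_bool (e' = e)"] assms(2)
    by (simp add: sole_contact_def)
  also have "\<dots> = (\<Prod>e'\<in>node_pairs n. exp (- (rate * h))) * (\<Prod>e'\<in>node_pairs n. ?w e')"
    by (rule prod.distrib)
  also have "(\<Prod>e'\<in>node_pairs n. ?w e') = ?w e"
    using assms(2) by (subst prod.remove[of _ e]) (auto intro!: prod.neutral)
  also have "(\<Prod>e'\<in>node_pairs n. exp (- (rate * h))) = exp (- (total_rate * h))"
    by (simp add: total_rate_def mult_ac flip: exp_of_nat_mult)
  finally show ?thesis by simp
qed

lemma increments_measurable:
  assumes "0 \<le> h" "e \<in> node_pairs n"
  shows "(\<lambda>\<omega>. increments h \<omega> i e) \<in> M \<rightarrow>\<^sub>M count_space UNIV"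
  using increments_indep[OF assms(1)] assms(2) by (auto simp: indep_vars_def2)

lemma events_increments:
  assumes "0 \<le> h"
  shows "{\<omega> \<in> space M. P (\<lambda>e\<in>node_pairs n. increments h \<omega> i e)} \<in> events"
proof -
  have "(\<lambda>\<omega>. \<lambda>e\<in>node_pairs n. increments h \<omega> i e)
      \<in> M \<rightarrow>\<^sub>M PiM (node_pairs n) (\<lambda>_. count_space UNIV)"
    using increments_measurable[OF assms] by (intro measurable_restrict)
  also have "PiM (node_pairs n) (\<lambda>_. count_space UNIV)
      = count_space (node_pairs n \<rightarrow>\<^sub>E (UNIV :: nat set))"
    by (rule count_space_PiM_finite) auto
  finally have *: "(\<lambda>\<omega>. \<lambda>e\<in>node_pairs n. increments h \<omega> i e)
      \<in> M \<rightarrow>\<^sub>M count_space (node_pairs n \<rightarrow>\<^sub>E UNIV)" .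
  have "(\<lambda>\<omega>. \<lambda>e\<in>node_pairs n. increments h \<omega> i e) -` ({f. P f} \<inter> (node_pairs n \<rightarrow>\<^sub>E UNIV)) \<inter> space M \<in> events"
    by (rule measurable_sets[OF *]) auto
  then show ?thesis by (rule back_subst[where P = "\<lambda>A. A \<in> events"]) auto
qed

lemma events_no_contact:
  "0 \<le> h \<Longrightarrow> {\<omega> \<in> space M. \<forall>e\<in>node_pairs n. increments h \<omega> i e = 0} \<in> events"
  using events_increments[of h "\<lambda>d. \<forall>e\<in>node_pairs n. d e = 0" i] by simp

lemma events_sole_contact:
  "0 \<le> h \<Longrightarrow> {\<omega> \<in> space M. sole_contact n (increments h \<omega> i) e} \<in> events"
  using events_increments[of h "\<lambda>d. sole_contact n d e" i] by (simp add: sole_contact_def)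

lemma events_crowded:
  "0 \<le> h \<Longrightarrow> {\<omega> \<in> space M. 1 < (\<Sum>e\<in>node_pairs n. increments h \<omega> i e)} \<in> events"
  using events_increments[of h "\<lambda>d. 1 < (\<Sum>e\<in>node_pairs n. d e)" i] by simp

text \<open>
  The complement contains the disjoint events of no contact and of a single contact by each of
  the pairs, whose probabilities add up to the first two Poisson weights of the mean
  \<open>total_rate * h\<close>.
\<close>

lemma prob_crowded:
  assumes "0 \<le> h"
  shows "prob {\<omega> \<in> space M. 1 < (\<Sum>e\<in>node_pairs n. increments h \<omega> i e)} \<le> (total_rate * h)\<^sup>2"
proof -
  let ?Z = "{\<omega> \<in> space M. \<forall>e\<in>node_pairs n. increments h \<omega> i e = 0}"
  let ?S = "\<lambda>e. {\<omega> \<in> space M. sole_contact n (increments h \<omega> i) e}"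
  have events: "?Z \<in> events" "\<And>e. ?S e \<in> events"
    using events_no_contact events_sole_contact assms by auto
  have good_event: "?Z \<union> (\<Union>e\<in>node_pairs n. ?S e) \<in> events"
    by (intro sets.Un sets.finite_UN events finite_node_pairs)
  have disjoint: "?Z \<inter> (\<Union>e\<in>node_pairs n. ?S e) = {}" "disjoint_family_on ?S (node_pairs n)"
    by (fastforce simp: sole_contact_def, auto simp: disjoint_family_on_def dest: sole_contact_unique)
  have "prob (?Z \<union> (\<Union>e\<in>node_pairs n. ?S e)) = prob ?Z + (\<Sum>e\<in>node_pairs n. prob (?S e))"
    using disjoint events
    by (subst finite_measure_Union)
       (auto intro!: sets.finite_UN finite_measure_finite_Union)
  also have "\<dots> = (1 + total_rate * h) * exp (- (total_rate * h))"
    using assms by (simp add: prob_no_contact prob_sole_contact) (simp add: total_rate_def algebra_simps)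
  finally have good: "prob (?Z \<union> (\<Union>e\<in>node_pairs n. ?S e))
      = (1 + total_rate * h) * exp (- (total_rate * h))" .
  have "(\<Sum>e'\<in>node_pairs n. d e') = 1" if "sole_contact n d e" for d e
  proof -
    have "(\<Sum>e'\<in>node_pairs n. d e') = (\<Sum>e'\<in>node_pairs n. if e' = e then 1 else 0)"
      using that by (intro sum.cong) (auto simp: sole_contact_def)
    then show ?thesis using that by (simp add: sole_contact_def)
  qed
  then have "{\<omega> \<in> space M. 1 < (\<Sum>e\<in>node_pairs n. increments h \<omega> i e)}
      \<subseteq> space M - (?Z \<union> (\<Union>e\<in>node_pairs n. ?S e))"
    by fastforce
  then have "prob {\<omega> \<in> space M. 1 < (\<Sum>e\<in>node_pairs n. increments h \<omega> i e)}
      \<le> prob (space M - (?Z \<union> (\<Union>e\<in>node_pairs n. ?S e)))"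
    using good_event by (intro finite_measure_mono) auto
  also have "\<dots> = 1 - (1 + total_rate * h) * exp (- (total_rate * h))"
    using good_event by (simp add: prob_compl good)
  also have "\<dots> \<le> (total_rate * h)\<^sup>2"
    using assms rate_pos by (intro one_minus_exp_le_square) (auto simp: total_rate_def)
  finally show ?thesis .
qed

lemma events_unresolved: "0 \<le> h \<Longrightarrow> {\<omega> \<in> space M. \<not> resolved h m \<omega>} \<in> events"
proof -
  assume "0 \<le> h"
  have "{\<omega> \<in> space M. \<not> resolved h m \<omega>}
      = (\<Union>i<m. {\<omega> \<in> space M. 1 < (\<Sum>e\<in>node_pairs n. increments h \<omega> i e)})"
    by (auto simp: resolved_def not_le)
  then show ?thesis using events_crowded[OF \<open>0 \<le> h\<close>] by auto
qed

lemma prob_unresolved: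
  assumes "0 \<le> h"
  shows "prob {\<omega> \<in> space M. \<not> resolved h m \<omega>} \<le> real m * (total_rate * h)\<^sup>2"
proof -
  have "{\<omega> \<in> space M. \<not> resolved h m \<omega>}
      = (\<Union>i<m. {\<omega> \<in> space M. 1 < (\<Sum>e\<in>node_pairs n. increments h \<omega> i e)})"
    by (auto simp: resolved_def not_le)
  also have "prob \<dots> \<le> (\<Sum>i<m. prob {\<omega> \<in> space M. 1 < (\<Sum>e\<in>node_pairs n. increments h \<omega> i e)})"
    using events_crowded[OF assms] by (intro finite_measure_subadditive_finite) auto
  also have "\<dots> \<le> (\<Sum>i<m. (total_rate * h)\<^sup>2)"
    by (intro sum_mono prob_crowded assms)
  finally show ?thesis by simp
qed

section \<open>Expectations along the chain\<close>

text \<open>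
  Both variables are functions of disjoint blocks of the independent increments. Measurability of
  these functions is automatic because finitely many counts form a countable discrete space.
\<close>

lemma grid_indep_contact:
  fixes g :: "(nat \<Rightarrow> node_state) \<Rightarrow> real"
  assumes "0 \<le> h"
  shows "indep_var borel (\<lambda>\<omega>. g (grid h \<omega> i))
    borel (\<lambda>\<omega>. of_bool (sole_contact n (increments h \<omega> i) e) :: real)"
proof -
  let ?A = "node_pairs n \<times> {..<i}" and ?B = "node_pairs n \<times> {i}"
  let ?X = "\<lambda>(e, i) \<omega>. increments h \<omega> i e"
  let ?P = "\<lambda>A. PiM A (\<lambda>_. count_space UNIV) :: (nat set \<times> nat \<Rightarrow> nat) measure"
  let ?G = "\<lambda>f. g (grid_chain n x0 (\<lambda>j e. f (e, j)) i)"
  let ?H = "\<lambda>f. of_bool (sole_contact n (\<lambda>e. f (e, i)) e) :: real"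
  have discrete: "?P A = count_space (A \<rightarrow>\<^sub>E UNIV)" if "finite A" for A
    by (rule count_space_PiM_finite) (use that in auto)
  have "indep_var (?P ?A) (\<lambda>\<omega>. \<lambda>j\<in>?A. ?X j \<omega>) (?P ?B) (\<lambda>\<omega>. \<lambda>j\<in>?B. ?X j \<omega>)"
    by (rule indep_var_restrict[OF increments_indep[OF assms]]) auto
  then have "indep_var borel (?G \<circ> (\<lambda>\<omega>. \<lambda>j\<in>?A. ?X j \<omega>)) borel (?H \<circ> (\<lambda>\<omega>. \<lambda>j\<in>?B. ?X j \<omega>))"
    by (rule indep_var_compose) (simp_all add: discrete)
  moreover have "?G \<circ> (\<lambda>\<omega>. \<lambda>j\<in>?A. ?X j \<omega>) = (\<lambda>\<omega>. g (grid h \<omega> i))"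
    by (auto simp: fun_eq_iff grid_def intro!: arg_cong[where f = g] grid_chain_cong)
  moreover have "?H \<circ> (\<lambda>\<omega>. \<lambda>j\<in>?B. ?X j \<omega>)
      = (\<lambda>\<omega>. of_bool (sole_contact n (increments h \<omega> i) e))"
    by (simp add: fun_eq_iff sole_contact_def)
  ultimately show ?thesis by simp
qed

lemma grid_borel_measurable:
  fixes g :: "(nat \<Rightarrow> node_state) \<Rightarrow> real"
  assumes "0 \<le> h"
  shows "(\<lambda>\<omega>. g (grid h \<omega> i)) \<in> borel_measurable M"
  using indep_var_rv1[OF grid_indep_contact[OF assms]] .

lemma grid_integrable:
  fixes g :: "(nat \<Rightarrow> node_state) \<Rightarrow> real"
  assumes "0 \<le> h" "\<And>x. \<bar>g x\<bar> \<le> B"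
  shows "integrable M (\<lambda>\<omega>. g (grid h \<omega> i))"
  using assms(2) by (intro integrable_const_bound[of _ B] grid_borel_measurable[OF assms(1)]) auto

text \<open>
  The discrete counterpart of the generator of the process, acting on a bounded function \<open>g\<close>. It
  is exact for every \<open>h\<close>, since the chain ignores intervals with several contacts.
\<close>

lemma expectation_grid_step:
  fixes g :: "(nat \<Rightarrow> node_state) \<Rightarrow> real"
  assumes h: "0 \<le> h" and bound: "\<And>x. \<bar>g x\<bar> \<le> B"
  shows "expectation (\<lambda>\<omega>. g (grid h \<omega> (Suc i))) - expectation (\<lambda>\<omega>. g (grid h \<omega> i))
    = exp (- (total_rate * h)) * (rate * h)
      * expectation (\<lambda>\<omega>. \<Sum>e\<in>node_pairs n. g (contact e (grid h \<omega> i)) - g (grid h \<omega> i))"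
proof -
  let ?p = "exp (- (total_rate * h)) * (rate * h)"
  let ?g = "\<lambda>e x. g (contact e x) - g x"
  let ?I = "\<lambda>e \<omega>. of_bool (sole_contact n (increments h \<omega> i) e) :: real"
  have g_bound: "\<bar>?g e x\<bar> \<le> 2 * B" for e x
    using bound[of x] bound[of "contact e x"] by (simp add: abs_le_iff)
  have int: "integrable M (\<lambda>\<omega>. ?g e (grid h \<omega> i))" for e
    using h g_bound by (rule grid_integrable)
  have I_eq: "?I e \<omega> = indicator {\<omega> \<in> space M. sole_contact n (increments h \<omega> i) e} \<omega>"
    if "\<omega> \<in> space M" for e \<omega>
    using that by simp
  have int_I: "integrable M (?I e)" for e
    using events_sole_contact[OF h, of i e]
    by (subst Bochner_Integration.integrable_cong[OF refl I_eq])
       (auto simp: integrable_indicator_iff less_top[symmetric])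
  have E_I: "expectation (?I e) = ?p" if "e \<in> node_pairs n" for e
    using events_sole_contact[OF h, of i e] prob_sole_contact[OF h that, of i]
    by (subst Bochner_Integration.integral_cong[OF refl I_eq]) auto
  note indep = grid_indep_contact[OF h, where i = i]
  have int_prod: "integrable M (\<lambda>\<omega>. ?g e (grid h \<omega> i) * ?I e \<omega>)" for e
    by (rule indep_var_integrable[OF indep int int_I])
  have "expectation (\<lambda>\<omega>. g (grid h \<omega> (Suc i))) - expectation (\<lambda>\<omega>. g (grid h \<omega> i))
      = expectation (\<lambda>\<omega>. g (grid h \<omega> (Suc i)) - g (grid h \<omega> i))"
    using grid_integrable[OF h, of g, OF bound] by simp
  also have "\<dots> = expectation (\<lambda>\<omega>. \<Sum>e\<in>node_pairs n. ?g e (grid h \<omega> i) * ?I e \<omega>)"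
    by (simp add: grid_def grid_step_increment)
  also have "\<dots> = (\<Sum>e\<in>node_pairs n. expectation (\<lambda>\<omega>. ?g e (grid h \<omega> i) * ?I e \<omega>))"
    by (rule Bochner_Integration.integral_sum) (rule int_prod)
  also have "\<dots> = (\<Sum>e\<in>node_pairs n. expectation (\<lambda>\<omega>. ?g e (grid h \<omega> i)) * ?p)"
    by (intro sum.cong refl)
       (simp only: indep_var_lebesgue_integral[OF indep int int_I] E_I)
  also have "\<dots> = ?p * (\<Sum>e\<in>node_pairs n. expectation (\<lambda>\<omega>. ?g e (grid h \<omega> i)))"
    by (simp add: sum_distrib_left mult.commute)
  also have "(\<Sum>e\<in>node_pairs n. expectation (\<lambda>\<omega>. ?g e (grid h \<omega> i)))
      = expectation (\<lambda>\<omega>. \<Sum>e\<in>node_pairs n. ?g e (grid h \<omega> i))"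
    by (rule Bochner_Integration.integral_sum[symmetric]) (rule int)
  finally show ?thesis .
qed

end

context complete_graph_consensus
begin

definition ones_prob :: "real \<Rightarrow> nat \<Rightarrow> real" where
  "ones_prob h i = expectation (\<lambda>\<omega>. of_bool (0 < initial_count n (grid h \<omega> i) St1))"

lemma ones_indicator_integrable:
  assumes "0 \<le> h"
  shows "integrable M (\<lambda>\<omega>. of_bool (0 < initial_count n (grid h \<omega> i) St1) :: real)"
  by (rule grid_integrable[OF assms, of "\<lambda>x. of_bool (0 < initial_count n x St1)" 1]) simp

lemma ones_prob_antimono:
  assumes "0 \<le> h" "i \<le> j"
  shows "ones_prob h j \<le> ones_prob h i"
  unfolding ones_prob_def
proof (intro integral_mono ones_indicator_integrable assms)
  fix \<omega>
  have "initial_count n (grid h \<omega> j) St1 \<le> initial_count n (grid h \<omega> i) St1"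
    using decseqD[OF decseq_initial_count_grid_chain assms(2)] by (simp add: grid_def)
  then show "of_bool (0 < initial_count n (grid h \<omega> j) St1)
      \<le> (of_bool (0 < initial_count n (grid h \<omega> i) St1) :: real)"
    by simp
qed

context
  fixes D c0
  assumes c0: "initial_count n x0 St1 = c0"
    and surplus: "initial_count n x0 St0 = c0 + D"
begin

abbreviation potential :: "(nat \<Rightarrow> node_state) \<Rightarrow> real" where
  "potential x \<equiv> phase_potential n D (initial_count n x St1)"

lemma potential_bounds: "0 \<le> potential x" "\<bar>potential x\<bar> \<le> phase_potential n D n"
  using two_nodes phase_potential_nonneg[of n D] phase_potential_mono[of n _ n D, OF _ initial_count_le]
  by (simp_all add: abs_of_nonneg)

lemma potential_step:
  assumes "0 \<le> h"
  shows "expectation (\<lambda>\<omega>. potential (grid h \<omega> (Suc i))) - expectation (\<lambda>\<omega>. potential (grid h \<omega> i))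
    = - (h * exp (- (total_rate * h)) * ones_prob h i)"
proof -
  have "(\<Sum>e\<in>node_pairs n. potential (contact e (grid h \<omega> i)) - potential (grid h \<omega> i))
      = - (real n - 1) * of_bool (0 < initial_count n (grid h \<omega> i) St1)" for \<omega>
    unfolding grid_def
    by (intro phase_potential_generator initial_count_diff_grid_chain) (simp add: c0 surplus)
  then have "expectation (\<lambda>\<omega>. \<Sum>e\<in>node_pairs n. potential (contact e (grid h \<omega> i)) - potential (grid h \<omega> i))
      = - (real n - 1) * ones_prob h i"
    by (simp add: ones_prob_def)
  moreover have rate: "rate * h * (- (real n - 1) * y) = - (h * y)" for y
    using two_nodes by (simp add: rate_def field_simps)
  ultimately show ?thesis
    by (simp only: expectation_grid_step[OF assms, of potential, OF potential_bounds(2)] mult.assoc rate)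
       (simp add: mult_ac)
qed

lemma potential_telescoped:
  assumes "0 \<le> h"
  shows "h * exp (- (total_rate * h)) * (\<Sum>i<m. ones_prob h i)
    = phase_potential n D c0 - expectation (\<lambda>\<omega>. potential (grid h \<omega> m))"
proof (induction m)
  case 0
  then show ?case by (simp add: grid_def c0 prob_space)
next
  case (Suc m)
  then show ?case using potential_step[OF assms, of m] by (simp add: distrib_left)
qed

text \<open>
  The probability that a one is left decreases along the chain, while its sum over the grid is
  bounded by the initial potential. So it is small at the end, and the potential vanishes
  without ones.
\<close>

lemma potential_leftover:
  assumes "0 < h" "0 < m"
  shows "expectation (\<lambda>\<omega>. potential (grid h \<omega> m))
    \<le> (phase_potential n D c0)\<^sup>2 * exp (total_rate * h) / (h * real m)"
proof -
  let ?F = "phase_potential n D c0" and ?E = "expectation (\<lambda>\<omega>. potential (grid h \<omega> m))"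
  have h: "0 \<le> h" using assms by simp
  have F: "0 \<le> ?F" using two_nodes by (intro phase_potential_nonneg) simp
  have "?E \<le> expectation (\<lambda>\<omega>. ?F * of_bool (0 < initial_count n (grid h \<omega> m) St1))"
  proof (intro integral_mono integrable_mult_right ones_indicator_integrable h)
    show "integrable M (\<lambda>\<omega>. potential (grid h \<omega> m))"
      using h potential_bounds(2) by (rule grid_integrable)
    fix \<omega>
    have "initial_count n (grid h \<omega> m) St1 \<le> c0"
      using decseqD[OF decseq_initial_count_grid_chain, of 0 m n x0] by (simp add: grid_def c0)
    then have "potential (grid h \<omega> m) \<le> ?F"
      using two_nodes by (intro phase_potential_mono) auto
    then show "potential (grid h \<omega> m) \<le> ?F * of_bool (0 < initial_count n (grid h \<omega> m) St1)"
      by (auto simp: phase_potential_def)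
  qed
  then have E: "?E \<le> ?F * ones_prob h m" by (simp add: ones_prob_def)
  have "h * exp (- (total_rate * h)) * (real m * ones_prob h m)
      = h * exp (- (total_rate * h)) * (\<Sum>i<m. ones_prob h m)"
    by simp
  also have "\<dots> \<le> h * exp (- (total_rate * h)) * (\<Sum>i<m. ones_prob h i)"
    using h by (intro mult_left_mono sum_mono ones_prob_antimono) auto
  also have "\<dots> \<le> ?F"
    using potential_telescoped[OF h, of m] potential_bounds(1) by (simp add: Bochner_Integration.integral_nonneg)
  finally have "ones_prob h m \<le> ?F * exp (total_rate * h) / (h * real m)"
    using assms by (simp add: field_simps exp_minus)
  then have "?F * ones_prob h m \<le> ?F * (?F * exp (total_rate * h) / (h * real m))"
    using F by (rule mult_left_mono)
  with E show ?thesis by (simp add: power2_eq_square mult_ac)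
qed

section \<open>The mean duration of the first phase\<close>

lemma truncated_measurable:
  "(\<lambda>\<omega>. enn2real (min (first_phase_duration n X \<omega>) (ennreal t))) \<in> borel_measurable M"
  using first_phase_duration_measurable by measurable

lemma truncated_bounds:
  assumes "0 \<le> t"
  shows "0 \<le> enn2real (min (first_phase_duration n X \<omega>) (ennreal t))"
    and "enn2real (min (first_phase_duration n X \<omega>) (ennreal t)) \<le> t"
  using assms by (auto intro: enn2real_leI)

lemma truncated_integrable:
  assumes "0 \<le> t"
  shows "integrable M (\<lambda>\<omega>. enn2real (min (first_phase_duration n X \<omega>) (ennreal t)))"
  using truncated_bounds[OF assms]
  by (intro integrable_const_bound[of _ t] truncated_measurable) auto

text \<open>
  On the exceptional event both quantities lie between \<open>0\<close> and \<open>h * m\<close>, so it costs at most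
  \<open>h * m\<close> times its probability.
\<close>

lemma truncated_expectation_grid:
  assumes "0 < h"
  shows "\<bar>expectation (\<lambda>\<omega>. enn2real (min (first_phase_duration n X \<omega>) (ennreal (h * real m))))
      - h * (\<Sum>i<m. ones_prob h i)\<bar> \<le> h + h * real m * (real m * (total_rate * h)\<^sup>2)"
proof -
  let ?T = "\<lambda>\<omega>. enn2real (min (first_phase_duration n X \<omega>) (ennreal (h * real m)))"
  let ?I = "\<lambda>i \<omega>. of_bool (0 < initial_count n (grid h \<omega> i) St1) :: real"
  let ?U = "{\<omega> \<in> space M. \<not> resolved h m \<omega>}"
  have h: "0 \<le> h" using assms by simp
  have int_T: "integrable M ?T" using h by (intro truncated_integrable) auto
  have int_S: "integrable M (\<lambda>\<omega>. h * (\<Sum>i<m. ?I i \<omega>))"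
    by (intro integrable_mult_right Bochner_Integration.integrable_sum ones_indicator_integrable h)
  have int_U: "integrable M (indicat_real ?U)"
    using events_unresolved[OF h, of m] by (simp add: integrable_indicator_iff less_top[symmetric])
  have bound: "AE \<omega> in M. \<bar>?T \<omega> - h * (\<Sum>i<m. ?I i \<omega>)\<bar> \<le> h + h * real m * indicat_real ?U \<omega>"
    using AE_regular AE_space
  proof eventually_elim
    case (elim \<omega>)
    show ?case
    proof (cases "resolved h m \<omega>")
      case True
      then show ?thesis using duration_grid_approx[OF elim(1) assms] by simp
    next
      case False
      have "0 \<le> (\<Sum>i<m. ?I i \<omega>)" by (intro sum_nonneg) simp
      then have S0: "0 \<le> h * (\<Sum>i<m. ?I i \<omega>)" using h by simp
      have "(\<Sum>i<m. ?I i \<omega>) \<le> (\<Sum>i<m. 1)" by (intro sum_mono) simp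
      then have S1: "h * (\<Sum>i<m. ?I i \<omega>) \<le> h * real m" using h by (intro mult_left_mono) auto
      have "indicat_real ?U \<omega> = 1" using False elim(2) by simp
      then show ?thesis
        using S0 S1 truncated_bounds[of "h * real m" \<omega>] h by (simp only: abs_le_iff mult_1_right) linarith
    qed
  qed
  have difference: "expectation ?T - h * (\<Sum>i<m. ones_prob h i)
      = expectation (\<lambda>\<omega>. ?T \<omega> - h * (\<Sum>i<m. ?I i \<omega>))"
  proof -
    have "expectation (\<lambda>\<omega>. h * (\<Sum>i<m. ?I i \<omega>)) = h * (\<Sum>i<m. ones_prob h i)"
      unfolding ones_prob_def integral_mult_right_zero
      by (subst Bochner_Integration.integral_sum) (rule ones_indicator_integrable[OF h] refl)+
    then show ?thesis by (simp only: Bochner_Integration.integral_diff[OF int_T int_S])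
  qed
  have "\<bar>expectation ?T - h * (\<Sum>i<m. ones_prob h i)\<bar>
      \<le> expectation (\<lambda>\<omega>. \<bar>?T \<omega> - h * (\<Sum>i<m. ?I i \<omega>)\<bar>)"
    unfolding difference by (rule integral_abs_bound)
  also have "\<dots> \<le> expectation (\<lambda>\<omega>. h + h * real m * indicat_real ?U \<omega>)"
    using int_T int_S int_U bound by (intro integral_mono_AE) auto
  also have "\<dots> = h + h * real m * prob ?U"
    using int_U events_unresolved[OF h, of m] by (simp add: prob_space)
  also have "\<dots> \<le> h + h * real m * (real m * (total_rate * h)\<^sup>2)"
    using h prob_unresolved[OF h, of m] by (intro add_left_mono mult_left_mono) auto
  finally show ?thesis .
qed

lemma truncated_expectation_error:
  assumes "0 < h" "0 < m"
  defines "F \<equiv> phase_potential n D c0"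
  shows "\<bar>expectation (\<lambda>\<omega>. enn2real (min (first_phase_duration n X \<omega>) (ennreal (h * real m))))
      - exp (total_rate * h) * F\<bar>
    \<le> h + h * real m * (real m * (total_rate * h)\<^sup>2)
      + exp (total_rate * h) * (F\<^sup>2 * exp (total_rate * h) / (h * real m))"
proof -
  define R where "R = expectation (\<lambda>\<omega>. potential (grid h \<omega> m))"
  have "exp (total_rate * h) * (h * exp (- (total_rate * h)) * (\<Sum>i<m. ones_prob h i))
      = exp (total_rate * h) * (F - R)"
    using potential_telescoped[of h m] assms by (simp add: R_def)
  then have sum_eq: "h * (\<Sum>i<m. ones_prob h i) = exp (total_rate * h) * F - exp (total_rate * h) * R"
    by (simp add: exp_minus field_simps)
  have "0 \<le> R" unfolding R_def using potential_bounds(1) by (intro Bochner_Integration.integral_nonneg) auto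
  moreover have "R \<le> F\<^sup>2 * exp (total_rate * h) / (h * real m)"
    using potential_leftover[OF assms(1,2)] by (simp add: R_def F_def)
  ultimately have "0 \<le> exp (total_rate * h) * R"
      "exp (total_rate * h) * R \<le> exp (total_rate * h) * (F\<^sup>2 * exp (total_rate * h) / (h * real m))"
    by (auto simp del: times_divide_eq_right intro!: mult_left_mono)
  then show ?thesis
    using truncated_expectation_grid[OF assms(1), of m] sum_eq by linarith
qed

text \<open>
  Truncation at \<open>k\<close> with \<open>k^4\<close> grid intervals: the mesh \<open>1 / k^3\<close> is so fine that the
  probability \<open>m * (\<Lambda> * h)^2 = (\<Lambda> / k)^2\<close> of an unresolved grid is small even against \<open>1 / k\<close>.
\<close>

lemma truncated_expectation_tendsto:
  "(\<lambda>k. expectation (\<lambda>\<omega>. enn2real (min (first_phase_duration n X \<omega>) (ennreal (real k)))))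
    \<longlonglongrightarrow> phase_potential n D c0"
proof -
  define F where "F = phase_potential n D c0"
  let ?E = "\<lambda>k. expectation (\<lambda>\<omega>. enn2real (min (first_phase_duration n X \<omega>) (ennreal (real k))))"
  let ?h = "\<lambda>k. 1 / real k ^ 3"
  let ?x = "\<lambda>k. exp (total_rate * ?h k)"
  have bound: "\<forall>\<^sub>F k in sequentially. norm (?E k - ?x k * F)
      \<le> ?h k + total_rate\<^sup>2 / real k + ?x k * (F\<^sup>2 * ?x k / real k)"
    using eventually_gt_at_top[of 0]
  proof eventually_elim
    case (elim k)
    define x where "x = real k"
    have x: "0 < x" using elim by (simp add: x_def)
    have t: "1 / x ^ 3 * real (k ^ 4) = x"
      and err: "x * (real (k ^ 4) * (total_rate * (1 / x ^ 3))\<^sup>2) = total_rate\<^sup>2 / x"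
      using x unfolding of_nat_power x_def[symmetric] 
      unfolding power4_eq_xxxx power3_eq_cube power2_eq_square by simp_all
    have "0 < 1 / x ^ 3" "0 < k ^ 4" using x elim by simp_all
    from truncated_expectation_error[OF this] show ?case
      unfolding t err F_def x_def[symmetric] real_norm_def .
  qed
  have vanishing: "(\<lambda>k. ?h k + total_rate\<^sup>2 / real k + ?x k * (F\<^sup>2 * ?x k / real k)) \<longlonglongrightarrow> 0"
    by real_asymp
  have "(\<lambda>k. ?E k - ?x k * F) \<longlonglongrightarrow> 0"
    by (rule Lim_null_comparison[OF bound vanishing])
  moreover have "(\<lambda>k. ?x k * F) \<longlonglongrightarrow> F"
    by real_asymp
  ultimately have "(\<lambda>k. (?E k - ?x k * F) + ?x k * F) \<longlonglongrightarrow> 0 + F"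
    by (rule tendsto_add)
  then show ?thesis by (simp add: F_def)
qed

lemma expected_first_phase_duration:
  "(\<integral>\<^sup>+ \<omega>. first_phase_duration n X \<omega> \<partial>M) = ennreal (phase_potential n D c0)"
proof (rule LIMSEQ_unique)
  let ?T = "\<lambda>k \<omega>. min (first_phase_duration n X \<omega>) (ennreal (real k))"
  show "(\<lambda>k. \<integral>\<^sup>+ \<omega>. ?T k \<omega> \<partial>M) \<longlonglongrightarrow> (\<integral>\<^sup>+ \<omega>. first_phase_duration n X \<omega> \<partial>M)"
  proof (rule nn_integral_LIMSEQ)
    show "incseq ?T"
      unfolding incseq_def le_fun_def by (intro allI impI min.mono order_refl ennreal_leI) simp
    show "?T k \<in> borel_measurable M" for k
      using first_phase_duration_measurable by measurable
    show "(\<lambda>k. ?T k \<omega>) \<longlonglongrightarrow> first_phase_duration n X \<omega>" for \<omega>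
    proof -
      have "(\<lambda>k. min (first_phase_duration n X \<omega>) (of_nat k)) \<longlonglongrightarrow> min (first_phase_duration n X \<omega>) top"
        by (intro tendsto_min tendsto_const of_nat_tendsto_top_ennreal)
      then show ?thesis by (simp add: ennreal_of_nat_eq_real_of_nat)
    qed
  qed
  have "(\<integral>\<^sup>+ \<omega>. ?T k \<omega> \<partial>M) = ennreal (expectation (\<lambda>\<omega>. enn2real (?T k \<omega>)))" for k
  proof -
    have "?T k \<omega> = ennreal (enn2real (?T k \<omega>))" for \<omega>
      by (rule ennreal_enn2real[symmetric]) (simp add: min_less_iff_disj)
    then have "(\<integral>\<^sup>+ \<omega>. ?T k \<omega> \<partial>M) = (\<integral>\<^sup>+ \<omega>. ennreal (enn2real (?T k \<omega>)) \<partial>M)"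
      by (intro nn_integral_cong)
    also have "\<dots> = ennreal (expectation (\<lambda>\<omega>. enn2real (?T k \<omega>)))"
      by (intro nn_integral_eq_integral truncated_integrable) auto
    finally show ?thesis .
  qed
  then show "(\<lambda>k. \<integral>\<^sup>+ \<omega>. ?T k \<omega> \<partial>M) \<longlonglongrightarrow> ennreal (phase_potential n D c0)"
    using tendsto_ennrealI[OF truncated_expectation_tendsto] by simp
qed

end

end

section \<open>Logarithmic growth\<close>

lemma abs_harm_minus_ln_le_1:
  assumes "0 < k"
  shows "\<bar>harm k - ln (real k)\<bar> \<le> 1"
proof -
  obtain m where k: "k = Suc m" using assms by (cases k) auto
  have "ln (real k) \<le> harm k"
    using ln_le_harm[of k] ln_le_cancel_iff[of "real k" "real k + 1"] assms by linarith
  moreover have "harm k - ln (real k) \<le> 1"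
    using decseqD[OF decseq_harm_diff_ln, of 0 m] by (simp add: k harm_def)
  ultimately show ?thesis by simp
qed

text \<open>
  Replacing each harmonic number by a logarithm costs at most \<open>1\<close>, and the prefactor
  \<open>(n - 1) / n\<close> shifts \<open>ln n\<close> by \<open>ln n / n\<close>, which is at most \<open>1\<close>; together this is the \<open>4\<close>.
\<close>

lemma phase_duration_minus_log_bound:
  assumes \<alpha>: "1 / 2 < \<alpha>" "\<alpha> < 1" and n: "1 < n"
    and S0: "real S0 = \<alpha> * real n" and S1: "real S1 = (1 - \<alpha>) * real n"
  shows "\<bar>(real n - 1) / (real S0 - real S1) * (harm S1 + harm (S0 - S1) - harm S0)
      - 1 / (2 * \<alpha> - 1) * ln (real n)\<bar>
    \<le> (4 + \<bar>ln (1 - \<alpha>) + ln (2 * \<alpha> - 1) - ln \<alpha>\<bar>) / (2 * \<alpha> - 1)"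
proof -
  define K where "K = ln (1 - \<alpha>) + ln (2 * \<alpha> - 1) - ln \<alpha>"
  define \<theta> where "\<theta> = harm S1 + harm (S0 - S1) - harm S0 - (K + ln (real n))"
  define u where "u = 1 - 1 / real n"
  have "real S1 < real S0" using \<alpha> n unfolding S0 S1 by (intro mult_strict_right_mono) auto
  then have less: "S1 < S0" by simp
  then have D: "real (S0 - S1) = (2 * \<alpha> - 1) * real n"
    by (simp add: of_nat_diff S0 S1 algebra_simps)
  have "0 < real S0" "0 < real S1" using \<alpha> n by (simp_all add: S0 S1)
  then have pos: "0 < S0" "0 < S1" "0 < S0 - S1" using less by simp_all
  have "K + ln (real n) = ln (real S1) + ln (real (S0 - S1)) - ln (real S0)"
    using \<alpha> n unfolding S0 S1 D K_def by (simp add: ln_mult)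
  then have \<theta>: "\<bar>\<theta>\<bar> \<le> 3"
    using abs_harm_minus_ln_le_1[OF pos(1)] abs_harm_minus_ln_le_1[OF pos(2)]
      abs_harm_minus_ln_le_1[OF pos(3)] unfolding \<theta>_def by linarith
  have "(real n - 1) / (real S0 - real S1) = u / (2 * \<alpha> - 1)"
    using \<alpha> n by (simp add: u_def S0 S1 field_simps)
  moreover have "harm S1 + harm (S0 - S1) - harm S0 = ln (real n) + (K + \<theta>)"
    by (simp add: \<theta>_def)
  ultimately have "(real n - 1) / (real S0 - real S1) * (harm S1 + harm (S0 - S1) - harm S0)
      - 1 / (2 * \<alpha> - 1) * ln (real n)
      = (u * (ln (real n) + (K + \<theta>)) - ln (real n)) / (2 * \<alpha> - 1)"
    by (simp add: diff_divide_distrib)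
  also have "u * (ln (real n) + (K + \<theta>)) - ln (real n) = u * (K + \<theta>) - ln (real n) / real n"
    by (simp add: u_def algebra_simps add_divide_distrib)
  finally have eq: "(real n - 1) / (real S0 - real S1) * (harm S1 + harm (S0 - S1) - harm S0)
      - 1 / (2 * \<alpha> - 1) * ln (real n) = (u * (K + \<theta>) - ln (real n) / real n) / (2 * \<alpha> - 1)" .
  have "\<bar>u * (K + \<theta>)\<bar> \<le> 1 * \<bar>K + \<theta>\<bar>"
    unfolding abs_mult using n by (intro mult_right_mono) (auto simp: u_def)
  moreover have "\<bar>K + \<theta>\<bar> \<le> \<bar>K\<bar> + 3" using \<theta> by linarith
  moreover have "0 \<le> ln (real n) / real n" "ln (real n) / real n \<le> 1"
    using n ln_le_minus_one[of "real n"] by (auto simp: field_simps)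
  ultimately have "\<bar>u * (K + \<theta>) - ln (real n) / real n\<bar> \<le> 4 + \<bar>K\<bar>"
    unfolding mult_1 by (smt (verit, best))
  then show ?thesis
    using \<alpha> unfolding eq K_def[symmetric] abs_divide by (simp add: divide_right_mono)
qed

theorem proposition1:
  shows
    "(\<forall>(M :: 'w measure) n x0 N X S0 S1.
        1 < n \<longrightarrow>
        interval_consensus M n (complete_graph_rate n) x0 N X \<longrightarrow>
        S0 = initial_count n x0 St0 \<longrightarrow> S1 = initial_count n x0 St1 \<longrightarrow>
        S0 + S1 = n \<longrightarrow> S0 > S1 \<longrightarrow> S1 > 0 \<longrightarrow>
          first_phase_duration n X \<in> borel_measurable M \<and>
          (\<integral>\<^sup>+ \<omega>. first_phase_duration n X \<omega> \<partial>M) =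
            ennreal ((real n - 1) / (real S0 - real S1) * (harm S1 + harm (S0 - S1) - harm S0)))
     \<and>
     (\<forall>(\<alpha> :: real) (M :: nat \<Rightarrow> 'w measure) x0 N X.
        1 / 2 < \<alpha> \<longrightarrow> \<alpha> < 1 \<longrightarrow>
        (\<forall>n. 1 < n \<longrightarrow> \<alpha> * real n \<in> \<nat> \<longrightarrow>
           interval_consensus (M n) n (complete_graph_rate n) (x0 n) (N n) (X n) \<and>
           real (initial_count n (x0 n) St0) = \<alpha> * real n \<and>
           real (initial_count n (x0 n) St1) = (1 - \<alpha>) * real n) \<longrightarrow>
        (\<lambda>n. enn2real (\<integral>\<^sup>+ \<omega>. first_phase_duration n (X n) \<omega> \<partial>M n)
               - 1 / (2 * \<alpha> - 1) * ln (real n))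
          \<in> O[at_top \<sqinter> principal {n. \<alpha> * real n \<in> \<nat>}](\<lambda>_. 1))"
proof (intro conjI allI impI)
  have duration: "first_phase_duration n X \<in> borel_measurable M"
      "(\<integral>\<^sup>+ \<omega>. first_phase_duration n X \<omega> \<partial>M)
        = ennreal ((real n - 1) / (real S0 - real S1) * (harm S1 + harm (S0 - S1) - harm S0))"
      "0 \<le> (real n - 1) / (real S0 - real S1) * (harm S1 + harm (S0 - S1) - harm S0)"
    if "1 < n" "interval_consensus M n (complete_graph_rate n) x0 N X"
      "S0 = initial_count n x0 St0" "S1 = initial_count n x0 St1" "S1 < S0"
    for M :: "'w measure" and n x0 N X S0 S1
  proof -
    interpret complete_graph_consensus M n x0 N X
      using that by (intro complete_graph_consensus.intro complete_graph_consensus_axioms.intro)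
    have closed_form: "phase_potential n (S0 - S1) S1
        = (real n - 1) / (real S0 - real S1) * (harm S1 + harm (S0 - S1) - harm S0)"
      using that(5) by (subst phase_potential_harm) (auto simp: of_nat_diff)
    show "first_phase_duration n X \<in> borel_measurable M"
      by (rule first_phase_duration_measurable)
    show "(\<integral>\<^sup>+ \<omega>. first_phase_duration n X \<omega> \<partial>M)
        = ennreal ((real n - 1) / (real S0 - real S1) * (harm S1 + harm (S0 - S1) - harm S0))"
      unfolding closed_form[symmetric]
      by (rule expected_first_phase_duration) (use that(3-5) in simp_all)
    show "0 \<le> (real n - 1) / (real S0 - real S1) * (harm S1 + harm (S0 - S1) - harm S0)"
      using phase_potential_nonneg[of n "S0 - S1" S1] that(1) by (simp add: closed_form)
  qed
  show "first_phase_duration n X \<in> borel_measurable M"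
    and "(\<integral>\<^sup>+ \<omega>. first_phase_duration n X \<omega> \<partial>M)
      = ennreal ((real n - 1) / (real S0 - real S1) * (harm S1 + harm (S0 - S1) - harm S0))"
    if "1 < n" "interval_consensus M n (complete_graph_rate n) x0 N X"
      "S0 = initial_count n x0 St0" "S1 = initial_count n x0 St1" "S1 < S0"
    for M :: "'w measure" and n x0 N X S0 S1
    using duration[OF that] by blast+
  fix \<alpha> :: real and M :: "nat \<Rightarrow> 'w measure" and x0 N X
  assume \<alpha>: "1 / 2 < \<alpha>" "\<alpha> < 1"
    and family: "\<forall>n. 1 < n \<longrightarrow> \<alpha> * real n \<in> \<nat> \<longrightarrow>
           interval_consensus (M n) n (complete_graph_rate n) (x0 n) (N n) (X n) \<and>
           real (initial_count n (x0 n) St0) = \<alpha> * real n \<and>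
           real (initial_count n (x0 n) St1) = (1 - \<alpha>) * real n"
  have "\<bar>enn2real (\<integral>\<^sup>+ \<omega>. first_phase_duration n (X n) \<omega> \<partial>M n) - 1 / (2 * \<alpha> - 1) * ln (real n)\<bar>
      \<le> (4 + \<bar>ln (1 - \<alpha>) + ln (2 * \<alpha> - 1) - ln \<alpha>\<bar>) / (2 * \<alpha> - 1)"
    if n: "1 < n" "\<alpha> * real n \<in> \<nat>" for n
  proof -
    define S0 S1 where "S0 = initial_count n (x0 n) St0" and "S1 = initial_count n (x0 n) St1"
    have consensus: "interval_consensus (M n) n (complete_graph_rate n) (x0 n) (N n) (X n)"
      and S: "real S0 = \<alpha> * real n" "real S1 = (1 - \<alpha>) * real n"
      using family n by (simp_all add: S0_def S1_def)
    have "real S1 < real S0" unfolding S using \<alpha> n by (intro mult_strict_right_mono) auto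
    then have "S1 < S0" by simp
    note duration = duration[OF n(1) consensus S0_def S1_def this]
    show ?thesis
      using phase_duration_minus_log_bound[OF \<alpha> n(1) S] duration(3) by (simp add: duration(2))
  qed
  then show "(\<lambda>n. enn2real (\<integral>\<^sup>+ \<omega>. first_phase_duration n (X n) \<omega> \<partial>M n)
               - 1 / (2 * \<alpha> - 1) * ln (real n))
          \<in> O[at_top \<sqinter> principal {n. \<alpha> * real n \<in> \<nat>}](\<lambda>_. 1)"
    by (intro bigoI) (auto simp: eventually_inf_principal intro!: eventually_mono[OF eventually_gt_at_top[of 1]])
qed

end
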